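(* For every integer $n\ge 7$, $\mathrm{capt}(n)=n-4$. Moreover, for every $n\ge 9$, a cop-win graph on $n$ vertices is CT-maximal if and only if it belongs to $\mathcal{H}_7^{+}$. For $n\le 8$ the values of $\mathrm{capt}(n)$ and the CT-maximal graphs on $n$ vertices are as follows (here $P_m$ is the path on $m$ vertices and $K_3$ the triangle): $n=1$: $\mathrm{capt}=0$, CT-maximal graphs: $P_1$. $n=2$: $\mathrm{capt}=1$: $P_2$. $n=3$: $\mathrm{capt}=1$: $P_3$ and $K_3$. $n=4$: $\mathrm{capt}=2$: $P_4$. $n=5$: $\mathrm{capt}=2$: $P_5$ and the type-0 graphs realizing $(2,3)$ and $(3,2)$. $n=6$: $\mathrm{capt}=3$: $P_6$. $n=7$: $\mathrm{capt}=3$: $P_7$, $H_7$, and the type-0 graphs realizing $(2,2,3)$, $(2,3,2)$, $(3,2,2)$. $n=8$: $\mathrm{capt}=4$: $P_8$ and every graph in $\mathcal{H}_7^{+1}$.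
   Context: All graphs are finite, nonempty, and reflexive (every vertex has a loop, so each vertex is adjacent to itself). $N[v]$ denotes the closed neighborhood of $v$ (all vertices adjacent to $v$, including $v$). For distinct vertices $v,w$, $w$ strictly corners $v$ if $N[v]\subsetneq N[w]$; $v$ is then a strict corner. A vertex dominates a set if it is adjacent to every vertex of the set. Cops and robbers: a cop chooses a vertex, then the robber does; then they alternate moves, cop first, each move going to an adjacent vertex or staying. The cop wins if she occupies the robber's vertex. $G$ is cop-win if the cop can force a win; the capture time $\mathrm{capt}(G)$ of a cop-win graph is the minimum number of cop moves (not counting her initial placement) needed to guarantee capture. $\mathrm{capt}(n)$ is the maximum capture time over cop-win graphs on $n$ vertices, and a cop-win graph on $n$ vertices is CT-maximal if its capture time equals $\mathrm{capt}(n)$. Corner ranking: set $G^{(1)}=G$, $k=1$. If $G^{(k)}$ is a clique, give all its vertices rank $k$ and stop. Else if $G^{(k)}$ has no strict corners, give all its vertices rank $\infty$ and stop. Else give every strict corner of $G^{(k)}$ rank $k$, let $G^{(k+1)}$ be the induced subgraph of $G^{(k)}$ obtained by deleting them, increase $k$ by one and repeat. The corner rank of $G$ is the largest rank of a vertex. $X_k$ is the set of vertices of rank $k$. If $G$ has finite corner rank $\alpha\ge 2$, $G$ is of type 1 if some (equivalently every) vertex of rank $\alpha$ dominates $V(G^{(\alpha-1)})$, and of type 0 otherwise. (Known: $G$ is cop-win iff its corner rank is finite, and then a type-$r$ graph has capture time $\alpha-r$.) A vector is a finite list of positive integers. The rank cardinality vector of $G$ with corner rank $\alpha$ is $(x_\alpha,x_{\alpha-1},\dots,x_1)$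 with $x_k=|X_k|$. A vector is realizable (resp. $r$-realizable, $r\in\{0,1\}$) if it is the rank cardinality vector of some cop-win graph (resp. some cop-win graph of type $r$); that graph realizes (resp. $r$-realizes) it. $H_7$ is the graph on vertices $a_1,a_2,b_1,b_2,c_1,c_2,d$ with edges $a_1a_2,a_1b_1,a_1b_2,a_2b_1,a_2b_2,a_2c_1,a_1c_2,b_1c_1,b_1c_2,b_1d,b_2c_1,b_2c_2,c_1d,c_2d$. For $k\ge 0$, $\mathcal{H}_7^{+k}$ is the set of graphs realizing the vector $(2,2,2,1,\dots,1)$ of length $4+k$, and $\mathcal{H}_7^{+}=\bigcup_{k\ge 0}\mathcal{H}_7^{+k}$. *)

theory Defs
  imports Main
begin

definition graph :: "'a set \<Rightarrow> ('a \<Rightarrow> 'a \<Rightarrow> bool) \<Rightarrow> bool" where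
  "graph V E \<longleftrightarrow> finite V \<and> V \<noteq> {} \<and> (\<forall>x\<in>V. E x x) \<and> (\<forall>x y. E x y \<longrightarrow> E y x)
     \<and> (\<forall>x y. E x y \<longrightarrow> x \<in> V \<and> y \<in> V)"

text \<open>cop_wins E k c r: the cop, at c and about to move, with the robber at r,
  can guarantee capture within k further cop moves.\<close>
fun cop_wins :: "('a \<Rightarrow> 'a \<Rightarrow> bool) \<Rightarrow> nat \<Rightarrow> 'a \<Rightarrow> 'a \<Rightarrow> bool" where
  "cop_wins E 0 c r = (c = r)"
| "cop_wins E (Suc m) c r =
     (c = r \<or> (\<exists>c'. E c c' \<and> (c' = r \<or> (\<forall>r'. E r r' \<longrightarrow> cop_wins E m c' r'))))"

definition cop_win :: "'a set \<Rightarrow> ('a \<Rightarrow> 'a \<Rightarrow> bool) \<Rightarrow> bool" where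
  "cop_win V E \<longleftrightarrow> (\<exists>k. \<exists>c\<in>V. \<forall>r\<in>V. cop_wins E k c r)"

definition capture_time :: "'a set \<Rightarrow> ('a \<Rightarrow> 'a \<Rightarrow> bool) \<Rightarrow> nat" where
  "capture_time V E = (LEAST k. \<exists>c\<in>V. \<forall>r\<in>V. cop_wins E k c r)"

text \<open>capt(n): maximum capture time over cop-win graphs on n vertices
  (vertex sets taken inside nat; every finite graph is isomorphic to such a one).\<close>
definition capt :: "nat \<Rightarrow> nat" where
  "capt n = (GREATEST t. \<exists>V :: nat set. \<exists>E. graph V E \<and> card V = n \<and> cop_win V E
                              \<and> capture_time V E = t)"

definition CT_maximal :: "'a set \<Rightarrow> ('a \<Rightarrow> 'a \<Rightarrow> bool) \<Rightarrow> bool" where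
  "CT_maximal V E \<longleftrightarrow> graph V E \<and> cop_win V E \<and> capture_time V E = capt (card V)"

definition nbhd :: "('a \<Rightarrow> 'a \<Rightarrow> bool) \<Rightarrow> 'a set \<Rightarrow> 'a \<Rightarrow> 'a set" where
  "nbhd E S v = {u \<in> S. E v u}"

definition strict_corners :: "('a \<Rightarrow> 'a \<Rightarrow> bool) \<Rightarrow> 'a set \<Rightarrow> 'a set" where
  "strict_corners E S = {v \<in> S. \<exists>w\<in>S. w \<noteq> v \<and> nbhd E S v \<subset> nbhd E S w}"

definition is_clique :: "('a \<Rightarrow> 'a \<Rightarrow> bool) \<Rightarrow> 'a set \<Rightarrow> bool" where
  "is_clique E S \<longleftrightarrow> (\<forall>x\<in>S. \<forall>y\<in>S. E x y)"

text \<open>Gk V E k is the vertex set of the paper's G^(k+1) (shifted index: Gk V E 0 = V(G)).\<close>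
fun Gk :: "'a set \<Rightarrow> ('a \<Rightarrow> 'a \<Rightarrow> bool) \<Rightarrow> nat \<Rightarrow> 'a set" where
  "Gk V E 0 = V"
| "Gk V E (Suc k) = Gk V E k - strict_corners E (Gk V E k)"

definition corner_rank :: "'a set \<Rightarrow> ('a \<Rightarrow> 'a \<Rightarrow> bool) \<Rightarrow> nat" where
  "corner_rank V E = Suc (LEAST k. is_clique E (Gk V E k))"

text \<open>X_k, for 1 <= k <= corner rank.\<close>
definition rank_class :: "'a set \<Rightarrow> ('a \<Rightarrow> 'a \<Rightarrow> bool) \<Rightarrow> nat \<Rightarrow> 'a set" where
  "rank_class V E k = (if k = corner_rank V E then Gk V E (k - 1)
                       else Gk V E (k - 1) - Gk V E k)"

definition type1 :: "'a set \<Rightarrow> ('a \<Rightarrow> 'a \<Rightarrow> bool) \<Rightarrow> bool" where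
  "type1 V E \<longleftrightarrow> corner_rank V E \<ge> 2 \<and>
     (\<exists>v \<in> rank_class V E (corner_rank V E). \<forall>u \<in> Gk V E (corner_rank V E - 2). E v u)"

definition type0 :: "'a set \<Rightarrow> ('a \<Rightarrow> 'a \<Rightarrow> bool) \<Rightarrow> bool" where
  "type0 V E \<longleftrightarrow> corner_rank V E \<ge> 2 \<and> \<not> type1 V E"

definition rcv :: "'a set \<Rightarrow> ('a \<Rightarrow> 'a \<Rightarrow> bool) \<Rightarrow> nat list" where
  "rcv V E = map (\<lambda>k. card (rank_class V E k)) (rev [1..<Suc (corner_rank V E)])"

definition realizes :: "'a set \<Rightarrow> ('a \<Rightarrow> 'a \<Rightarrow> bool) \<Rightarrow> nat list \<Rightarrow> bool" where
  "realizes V E vec \<longleftrightarrow> graph V E \<and> cop_win V E \<and> rcv V E = vec"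

definition zero_realizes :: "'a set \<Rightarrow> ('a \<Rightarrow> 'a \<Rightarrow> bool) \<Rightarrow> nat list \<Rightarrow> bool" where
  "zero_realizes V E vec \<longleftrightarrow> realizes V E vec \<and> type0 V E"

definition in_H7plus_k :: "nat \<Rightarrow> 'a set \<Rightarrow> ('a \<Rightarrow> 'a \<Rightarrow> bool) \<Rightarrow> bool" where
  "in_H7plus_k k V E \<longleftrightarrow> realizes V E ([2, 2, 2] @ replicate (Suc k) 1)"

definition in_H7plus :: "'a set \<Rightarrow> ('a \<Rightarrow> 'a \<Rightarrow> bool) \<Rightarrow> bool" where
  "in_H7plus V E \<longleftrightarrow> (\<exists>k. in_H7plus_k k V E)"

definition graph_iso :: "'a set \<Rightarrow> ('a \<Rightarrow> 'a \<Rightarrow> bool) \<Rightarrow> 'b set \<Rightarrow> ('b \<Rightarrow> 'b \<Rightarrow> bool) \<Rightarrow> bool" where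
  "graph_iso V E W F \<longleftrightarrow> (\<exists>f. bij_betw f V W \<and> (\<forall>x\<in>V. \<forall>y\<in>V. E x y \<longleftrightarrow> F (f x) (f y)))"

definition path_V :: "nat \<Rightarrow> nat set" where "path_V m = {0..<m}"
definition path_E :: "nat \<Rightarrow> nat \<Rightarrow> nat \<Rightarrow> bool" where
  "path_E m i j \<longleftrightarrow> i < m \<and> j < m \<and> i \<le> j + 1 \<and> j \<le> i + 1"

definition K3_V :: "nat set" where "K3_V = {0, 1, 2}"
definition K3_E :: "nat \<Rightarrow> nat \<Rightarrow> bool" where "K3_E i j \<longleftrightarrow> i \<in> K3_V \<and> j \<in> K3_V"

text \<open>H_7 with a1=0, a2=1, b1=2, b2=3, c1=4, c2=5, d=6; loops added, edges symmetric.\<close>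
definition H7_V :: "nat set" where "H7_V = {0..<7}"
definition H7_edges :: "(nat \<times> nat) set" where
  "H7_edges = {(0,1),(0,2),(0,3),(1,2),(1,3),(1,4),(0,5),(2,4),(2,5),(2,6),(3,4),(3,5),(4,6),(5,6)}"
definition H7_E :: "nat \<Rightarrow> nat \<Rightarrow> bool" where
  "H7_E i j \<longleftrightarrow> (i \<in> H7_V \<and> i = j) \<or> (i, j) \<in> H7_edges \<or> (j, i) \<in> H7_edges"

end

(*
  Write S_j for Gk V E j.  Mapping every strict corner of S_j to a vertex of S_(j+1) that corners
  it gives retractions, and following the shadows of the players under them shows that the cop
  can win within j + 1 moves iff some vertex of S_j is adjacent to all of S_j.  Hence the
  capture time of a non-complete graph is its corner rank minus its type, and the extremal question is which
  rank cardinality vectors are realizable with few vertices.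

  A class of size 1 is very restrictive: its vertex s is adjacent to the whole next class, whose
  corners are in turn not adjacent to s, so some vertex above the next class is adjacent to all
  of that class.  Apart from (2,2,2,1), this excludes a class of size 1 within the top four
  classes unless these classes have too many vertices in total.  Moreover, removing the strict
  corners of a graph can leave a path with at least three vertices only if it removes a
  new leaf at each end, so that class has at least two vertices.  Counting vertices leaves the
  paths with at most 8 vertices, the vectors (2,2,2,1,...,1) and a few short vectors of type 0.
*)
theory Submission
  imports Defs
begin

section \<open>The capture time in terms of dominating vertices\<close>

text \<open>A vertex of \<open>Gk V E (Suc j)\<close> is no strict corner of
  \<open>Gk V E j\<close>, but it may become one once the class between the two levels is gone.
  Whenever this happens, the removed class contained a neighbour of it which the cornering vertex
  misses. If that class is \<open>{s}\<close>, the neighbour can only be \<open>s\<close>; this is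
  why \<open>s\<close> sees the whole class removed next, and why whatever corners \<open>s\<close>
  sees that class too.

  The constants come from the following balance, with corner rank \<open>m + 2\<close>. Type 1 gives
  capture time \<open>m + 1\<close> and, for \<open>m \<ge> 2\<close>, needs at least
  \<open>m + 5\<close> vertices, a cost reached by the top (2,2,2,1). Type 0 gives capture time
  \<open>m + 2\<close>, but needs at least \<open>m + 7\<close> vertices for
  \<open>m \<ge> 3\<close>. So for large \<open>n\<close> only type 1 attains \<open>n - 4\<close>.
  Paths attain \<open>n div 2\<close>, which exceeds \<open>n - 4\<close> up to order 6 and equals
  it for orders 7 and 8; hence the exceptional small orders.\<close>

definition core :: "('a \<Rightarrow> 'a \<Rightarrow> bool) \<Rightarrow> 'a set \<Rightarrow> 'a set" where
  "core E S = S - strict_corners E S"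

definition dominated :: "('a \<Rightarrow> 'a \<Rightarrow> bool) \<Rightarrow> 'a set \<Rightarrow> bool" where
  "dominated E S \<longleftrightarrow> (\<exists>v\<in>S. \<forall>u\<in>S. E v u)"

definition refl_graph :: "('a \<Rightarrow> 'a \<Rightarrow> bool) \<Rightarrow> 'a set \<Rightarrow> bool" where
  "refl_graph E S \<longleftrightarrow> finite S \<and> S \<noteq> {} \<and> (\<forall>x\<in>S. E x x) \<and> (\<forall>x y. E x y \<longrightarrow> E y x)"

lemma Gk_Suc_core: "Gk V E (Suc k) = core E (Gk V E k)"
  by (simp add: core_def)

lemma core_subset: "core E S \<subseteq> S"
  by (auto simp: core_def)

text \<open>Otherwise \<open>w\<close> would strictly corner \<open>v\<close>. In contrapositive
  form this is the source of private neighbours: against any vertex that sees something it misses, a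
  core vertex has a neighbour which that vertex misses.\<close>

lemma noncorner:
  assumes "v \<in> core E S" "w \<in> S" "\<And>u. u \<in> S \<Longrightarrow> E v u \<Longrightarrow> E w u" "u \<in> S" "E w u"
  shows "E v u"
proof (rule ccontr)
  assume n: "\<not> E v u"
  with assms(5) have "w \<noteq> v" by auto
  moreover have "nbhd E S v \<subset> nbhd E S w"
    using assms n by (auto simp: nbhd_def)
  ultimately show False using assms(1,2) by (auto simp: core_def strict_corners_def)
qed

lemma core_twin:
  assumes "v \<in> core E S" "w \<in> S" "nbhd E S w = nbhd E S v"
  shows "w \<in> core E S"
  using assms by (auto simp: core_def strict_corners_def)

text \<open>Among the vertices whose neighbourhood properly contains that of \<open>v\<close>, one
  of largest degree cannot be a strict corner itself. So the cornering vertex may be taken in the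
  core, as the retractions require.\<close>

lemma cornerE:
  assumes "finite S" "v \<in> S" "v \<notin> core E S"
  obtains w where "w \<in> core E S" "\<And>u. u \<in> S \<Longrightarrow> E v u \<Longrightarrow> E w u"
    "\<exists>u\<in>S. E w u \<and> \<not> E v u"
proof -
  let ?A = "{w \<in> S. nbhd E S v \<subset> nbhd E S w}"
  have "?A \<noteq> {}" using assms(2,3) by (auto simp: core_def strict_corners_def)
  moreover have "finite ?A" using assms(1) by auto
  ultimately have "Max ((\<lambda>w. card (nbhd E S w)) ` ?A) \<in> (\<lambda>w. card (nbhd E S w)) ` ?A"
    by (intro Max_in) auto
  then obtain w where w: "w \<in> ?A" and "Max ((\<lambda>w. card (nbhd E S w)) ` ?A) = card (nbhd E S w)"
    by blast
  then have mx: "card (nbhd E S x) \<le> card (nbhd E S w)" if "x \<in> ?A" for x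
    using \<open>finite ?A\<close> that by (metis (no_types, lifting) Max_ge finite_imageI imageI)
  have fin: "finite (nbhd E S x)" for x using assms(1) by (auto simp: nbhd_def)
  have "w \<in> core E S"
  proof (rule ccontr)
    assume "w \<notin> core E S"
    then obtain x where x: "x \<in> S" "nbhd E S w \<subset> nbhd E S x"
      using w by (auto simp: core_def strict_corners_def)
    then have "x \<in> ?A" using w by auto
    moreover have "card (nbhd E S w) < card (nbhd E S x)"
      using x(2) fin by (simp add: psubset_card_mono)
    ultimately show False using mx by force
  qed
  then show thesis using that w by (auto simp: nbhd_def)
qed

lemma refl_graph_core:
  assumes "refl_graph E S" shows "refl_graph E (core E S)"
proof -
  have "core E S \<noteq> {}"
  proof -
    obtain v where "v \<in> S" using assms by (auto simp: refl_graph_def)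
    then show ?thesis using cornerE[of S v E] assms by (metis empty_iff refl_graph_def)
  qed
  then show ?thesis using assms finite_subset[OF core_subset[of E S]] core_subset[of E S]
    by (auto simp: refl_graph_def)
qed

lemma refl_graph_Gk:
  assumes "graph V E" shows "refl_graph E (Gk V E k)"
proof (induction k)
  case 0 then show ?case using assms by (simp add: graph_def refl_graph_def)
next
  case (Suc k) then show ?case unfolding Gk_Suc_core by (rule refl_graph_core)
qed

lemma dominating_in_core:
  assumes "v \<in> S" "\<forall>u\<in>S. E v u" shows "v \<in> core E S"
  using assms by (auto simp: core_def strict_corners_def nbhd_def)

text \<open>A dominating vertex sees everything that a core vertex sees, so by
  \<open>noncorner\<close> the core vertex is dominating as well.\<close>

lemma core_dominated:
  assumes "refl_graph E S" "dominated E S"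
  shows "core E S = {v \<in> S. \<forall>u\<in>S. E v u}"
proof -
  obtain d where d: "d \<in> S" "\<forall>u\<in>S. E d u" using assms(2) by (auto simp: dominated_def)
  have "\<forall>u\<in>S. E v u" if v: "v \<in> core E S" for v
    using noncorner[OF v d(1)] d by auto
  then show ?thesis using dominating_in_core[of _ S E] core_subset[of E S] by blast
qed

lemma clique_core_of_dominated:
  assumes "refl_graph E S" "dominated E S" shows "is_clique E (core E S)"
  using core_dominated[OF assms] by (auto simp: is_clique_def)

lemma dominated_clique:
  assumes "refl_graph E S" "is_clique E S" shows "dominated E S"
  using assms by (auto simp: is_clique_def dominated_def refl_graph_def)

text \<open>Both ends of a non-edge fail to dominate, so both are removed.\<close>

lemma removed_card_ge_2_of_dominated:
  assumes "refl_graph E S" "dominated E S" "\<not> is_clique E S"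
  shows "card (S - core E S) \<ge> 2"
proof -
  obtain x y where xy: "x \<in> S" "y \<in> S" "\<not> E x y" using assms(3) by (auto simp: is_clique_def)
  then have "x \<noteq> y" "\<not> E y x" using assms(1) by (auto simp: refl_graph_def)
  then have "{x, y} \<subseteq> S - core E S" using xy core_dominated[OF assms(1,2)] by auto
  moreover have "finite (S - core E S)" using assms(1) by (auto simp: refl_graph_def)
  ultimately show ?thesis using card_mono \<open>x \<noteq> y\<close> by (metis card_2_iff)
qed

section \<open>Retractions onto the core, and the shadows of the players\<close>

definition retr :: "('a \<Rightarrow> 'a \<Rightarrow> bool) \<Rightarrow> 'a set \<Rightarrow> 'a \<Rightarrow> 'a" where
  "retr E S v = (if v \<in> core E S then v
     else SOME w. w \<in> core E S \<and> (\<forall>u\<in>S. E v u \<longrightarrow> E w u))"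

lemma retr_id: "v \<in> core E S \<Longrightarrow> retr E S v = v"
  by (simp add: retr_def)

lemma retr:
  assumes "finite S" "v \<in> S"
  shows "retr E S v \<in> core E S" "\<And>u. u \<in> S \<Longrightarrow> E v u \<Longrightarrow> E (retr E S v) u"
proof -
  have "retr E S v \<in> core E S \<and> (\<forall>u\<in>S. E v u \<longrightarrow> E (retr E S v) u)"
  proof (cases "v \<in> core E S")
    case True then show ?thesis by (simp add: retr_def)
  next
    case False
    then have "\<exists>w. w \<in> core E S \<and> (\<forall>u\<in>S. E v u \<longrightarrow> E w u)"
      using cornerE[OF assms False] by metis
    from someI_ex[OF this] False show ?thesis by (simp add: retr_def)
  qed
  then show "retr E S v \<in> core E S" "\<And>u. u \<in> S \<Longrightarrow> E v u \<Longrightarrow> E (retr E S v) u" by auto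
qed

fun shadow :: "'a set \<Rightarrow> ('a \<Rightarrow> 'a \<Rightarrow> bool) \<Rightarrow> nat \<Rightarrow> 'a \<Rightarrow> 'a" where
  "shadow V E 0 v = v"
| "shadow V E (Suc k) v = retr E (Gk V E k) (shadow V E k v)"

context
  fixes V :: "'a set" and E
  assumes G: "graph V E"
begin

lemma Esym: "E x y \<Longrightarrow> E y x" using G by (auto simp: graph_def)
lemma EV: "E x y \<Longrightarrow> x \<in> V \<and> y \<in> V" using G by (auto simp: graph_def)
lemma Gk_fin: "finite (Gk V E k)" using refl_graph_Gk[OF G] by (auto simp: refl_graph_def)
lemma Gk_refl: "x \<in> Gk V E k \<Longrightarrow> E x x" using refl_graph_Gk[OF G] by (auto simp: refl_graph_def)

lemma shadow_in: "v \<in> V \<Longrightarrow> shadow V E k v \<in> Gk V E k"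
proof (induction k)
  case (Suc k) then show ?case
    unfolding Gk_Suc_core shadow.simps using retr(1)[OF Gk_fin] by blast
qed simp

lemma Gk_Suc_subset: "Gk V E (Suc k) \<subseteq> Gk V E k" by auto

lemma shadow_id: "v \<in> Gk V E k \<Longrightarrow> shadow V E k v = v"
proof (induction k)
  case (Suc k)
  then have "shadow V E k v = v" "v \<in> core E (Gk V E k)" by (auto simp: core_def)
  then show ?case by (simp add: retr_id)
qed simp

lemma shadow_absorb:
  assumes "v \<in> V" "u \<in> Gk V E k" "E (shadow V E k v) u" shows "E (shadow V E (Suc k) v) u"
  using retr(2)[OF Gk_fin shadow_in[OF assms(1)]] assms by simp

text \<open>Since a retracted vertex keeps all its neighbours, the two ends of an edge can be
  retracted one after the other. Hence the shadow of a legal move is a legal move.\<close>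

lemma shadow_adj: "E u v \<Longrightarrow> E (shadow V E k u) (shadow V E k v)"
proof (induction k)
  case (Suc k)
  have uv: "u \<in> V" "v \<in> V" using EV[OF Suc.prems] by auto
  have "E (shadow V E (Suc k) u) (shadow V E k v)"
    by (rule shadow_absorb) (use uv Suc shadow_in in auto)
  then show ?case using shadow_absorb[of v "shadow V E (Suc k) u" k] shadow_in[of u "Suc k"] uv Esym
      Gk_Suc_subset by blast
qed simp

text \<open>The cop, standing on the \<open>k\<close>-th shadow of the robber, can always move to the \<open>(k-1)\<close>-st one.\<close>
lemma cop_wins_shadow:
  "c \<in> V \<Longrightarrow> r \<in> V \<Longrightarrow> E c (shadow V E k r) \<Longrightarrow> cop_wins E (Suc k) c r"
proof (induction k arbitrary: c r)
  case (Suc k)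
  let ?c = "shadow V E (Suc k) r"
  have "cop_wins E (Suc k) ?c r'" if r': "E r r'" for r'
  proof (rule Suc.IH)
    show "?c \<in> V" using shadow_in[of r "Suc k"] Suc.prems EV by blast
    show "r' \<in> V" using EV r' by blast
    show "E ?c (shadow V E k r')"
      using shadow_absorb[of r] shadow_adj[OF r', of k] shadow_in EV[OF r'] by blast
  qed
  then show ?case using Suc.prems by (metis cop_wins.simps(2))
qed auto

text \<open>The robber stays in \<open>Gk V E k\<close> and not adjacent to the shadow of the cop.  If he cannot move on to
  such a position in \<open>Gk V E (k - 1)\<close>, then the shadow there of the cop is a twin of his vertex.\<close>
lemma not_cop_wins_shadow:
  "c \<in> V \<Longrightarrow> r \<in> Gk V E k \<Longrightarrow> \<not> E (shadow V E k c) r \<Longrightarrow> \<not> cop_wins E (Suc k) c r"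
proof (induction k arbitrary: c r)
  case 0
  then show ?case using Gk_refl[of r 0] by auto
next
  case (Suc k)
  let ?S = "Gk V E k"
  have ne: "c \<noteq> r" using Suc.prems shadow_id Gk_refl by metis
  have rS: "r \<in> ?S" and rc: "r \<in> core E ?S" using Suc.prems(2) by (auto simp: core_def)
  have "\<not> (c' = r \<or> (\<forall>r'. E r r' \<longrightarrow> cop_wins E (Suc k) c' r'))" if c': "E c c'" for c'
  proof
    assume asm: "c' = r \<or> (\<forall>r'. E r r' \<longrightarrow> cop_wins E (Suc k) c' r')"
    have c'V: "c' \<in> V" using EV c' by blast
    have adj: "E (shadow V E (Suc k) c) (shadow V E (Suc k) c')" by (rule shadow_adj[OF c'])
    have "c' \<noteq> r" using adj shadow_id[OF Suc.prems(2)] Suc.prems(3) by auto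
    then have w: "\<And>r'. E r r' \<Longrightarrow> cop_wins E (Suc k) c' r'" using asm by auto
    let ?w = "shadow V E k c'"
    have wS: "?w \<in> ?S" using shadow_in c'V by auto
    have sub: "E ?w u" if "u \<in> ?S" "E r u" for u
      using Suc.IH[OF c'V that(1)] w[OF that(2)] by blast
    have sup: "E r u" if "u \<in> ?S" "E ?w u" for u
      using noncorner[OF rc wS sub that] .
    have "?w \<in> core E ?S"
      by (rule core_twin[OF rc wS]) (use sub sup in \<open>auto simp: nbhd_def\<close>)
    then have "shadow V E (Suc k) c' = ?w" by (simp add: retr_id)
    then have "E ?w (shadow V E (Suc k) c)" using adj Esym by (simp del: shadow.simps)
    moreover have "shadow V E (Suc k) c \<in> ?S"
      using shadow_in[OF Suc.prems(1)] Gk_Suc_subset by blast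
    ultimately have "E r (shadow V E (Suc k) c)" using sup by blast
    then show False using Suc.prems(3) Esym by blast
  qed
  then show ?case using ne by (metis cop_wins.simps(2))
qed

text \<open>The cop starts on a dominating vertex of the level, which sees the shadow of every
  robber position. Conversely, the shadow of a winning start dominates the level.\<close>

lemma cop_wins_iff_dominated:
  "(\<exists>c\<in>V. \<forall>r\<in>V. cop_wins E (Suc k) c r) \<longleftrightarrow> dominated E (Gk V E k)"
proof
  assume "\<exists>c\<in>V. \<forall>r\<in>V. cop_wins E (Suc k) c r"
  then obtain c where c: "c \<in> V" "\<forall>r\<in>V. cop_wins E (Suc k) c r" by auto
  have sub: "Gk V E k \<subseteq> V" by (induction k) auto
  have "E (shadow V E k c) r" if "r \<in> Gk V E k" for r
    using not_cop_wins_shadow[OF c(1) that] c(2) that sub by blast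
  then show "dominated E (Gk V E k)" using shadow_in[OF c(1)] by (auto simp: dominated_def)
next
  assume "dominated E (Gk V E k)"
  then obtain v where v: "v \<in> Gk V E k" "\<forall>u\<in>Gk V E k. E v u" by (auto simp: dominated_def)
  have vV: "v \<in> V" using EV Gk_refl v(1) by blast
  have "cop_wins E (Suc k) v r" if "r \<in> V" for r
    using cop_wins_shadow[OF vV that] v(2) shadow_in[OF that] by blast
  then show "\<exists>c\<in>V. \<forall>r\<in>V. cop_wins E (Suc k) c r" using vV by blast
qed

lemma cop_win_iff: "cop_win V E \<longleftrightarrow> (\<exists>k. dominated E (Gk V E k))"
proof -
  \<comment> \<open>A win in zero moves forces a single vertex, which dominates by its loop; the
    equivalence for \<open>Suc k\<close> does not cover this case.\<close>
  have "dominated E (Gk V E 0)" if "\<exists>c\<in>V. \<forall>r\<in>V. cop_wins E 0 c r"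
    using that Gk_refl[of _ 0] by (simp add: dominated_def) metis
  then show ?thesis unfolding cop_win_def cop_wins_iff_dominated[symmetric]
    using cop_wins_iff_dominated[of 0] by (metis not0_implies_Suc)
qed

lemma capture_time_eq_Suc:
  assumes "card V \<ge> 2" "dominated E (Gk V E k)" "\<And>j. j < k \<Longrightarrow> \<not> dominated E (Gk V E j)"
  shows "capture_time V E = Suc k"
  unfolding capture_time_def
proof (rule Least_equality)
  show "\<exists>c\<in>V. \<forall>r\<in>V. cop_wins E (Suc k) c r" using assms(2) cop_wins_iff_dominated by blast
  fix y assume y: "\<exists>c\<in>V. \<forall>r\<in>V. cop_wins E y c r"
  show "Suc k \<le> y"
  proof (cases y)
    case 0
    then obtain c where "V \<subseteq> {c}" using y by (metis cop_wins.simps(1) insertI1 subsetI)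
    then have "card V \<le> 1" using card_mono[of "{c}" V] by simp
    then show ?thesis using assms(1) by simp
  next
    case (Suc j)
    then have "dominated E (Gk V E j)" using y cop_wins_iff_dominated by blast
    then show ?thesis using assms(3)[of j] Suc by (meson Suc_le_mono not_less)
  qed
qed

lemma capture_time_singleton:
  assumes "card V = 1" shows "cop_win V E" "capture_time V E = 0"
proof -
  obtain v where "V = {v}" using assms card_1_singletonE by blast
  then have "\<exists>c\<in>V. \<forall>r\<in>V. cop_wins E 0 c r" by auto
  then show "cop_win V E" "capture_time V E = 0"
    unfolding cop_win_def capture_time_def by (blast, simp)
qed

end

section \<open>Rank classes with a single vertex\<close>

lemma refl_graphD:
  assumes "refl_graph E S"
  shows "finite S" "x \<in> S \<Longrightarrow> E x x" "E x y \<Longrightarrow> E y x"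
  using assms by (auto simp: refl_graph_def)

lemma core_subsetD: "x \<in> core E S \<Longrightarrow> x \<in> S"
  by (simp add: core_def)

lemma corner_ex:
  assumes "finite S" "v \<in> S" "v \<notin> core E S"
  shows "\<exists>w\<in>core E S. (\<forall>u\<in>S. E v u \<longrightarrow> E w u) \<and> (\<exists>u\<in>S. E w u \<and> \<not> E v u)"
  using cornerE[OF assms] by metis

text \<open>Within the core, \<open>u\<close> sees properly more than \<open>y\<close>, yet it does
  not corner \<open>y\<close> in \<open>S\<close>. The neighbour of \<open>y\<close> that prevents
  this lies outside the core, and \<open>s\<close> is the only candidate.\<close>

lemma single_corner:
  assumes "S - core E S = {s}" "y \<in> core E S" "u \<in> S"
    and "\<And>x. x \<in> core E S \<Longrightarrow> E y x \<Longrightarrow> E u x"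
    and "\<exists>x\<in>core E S. E u x \<and> \<not> E y x"
  shows "E y s" "\<not> E u s"
proof -
  have "\<exists>x\<in>S. E y x \<and> \<not> E u x"
    using noncorner[OF assms(2,3)] assms(5) core_subset[of E S] by blast
  moreover have "x \<in> core E S \<or> x = s" if "x \<in> S" for x using assms(1) that by blast
  ultimately have "E y s \<and> \<not> E u s" using assms(4) by blast
  then show "E y s" "\<not> E u s" by auto
qed

text \<open>A vertex \<open>v\<close> that dominates the core but misses \<open>s\<close> can be
  replaced by the vertex \<open>w\<close> that corners \<open>s\<close>.\<close>

lemma dominated_of_single_corner:
  assumes R: "refl_graph E S" and d: "dominated E (core E S)" and s: "S - core E S = {s}"
  shows "dominated E S"
proof -
  note r = refl_graphD[OF R]
  obtain v where v: "v \<in> core E S" "\<And>x. x \<in> core E S \<Longrightarrow> E v x"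
    using d by (auto simp: dominated_def dest: core_subsetD)
  have sS: "s \<in> S" "s \<notin> core E S" and S: "S = insert s (core E S)"
    using s core_subset[of E S] by auto
  obtain w where w: "w \<in> core E S" "\<And>u. u \<in> S \<Longrightarrow> E s u \<Longrightarrow> E w u"
    using corner_ex[OF r(1) sS] by blast
  have ws: "E w s" using w(2) sS r(2) by blast
  show ?thesis
  proof (cases "E v s")
    case True
    then have "\<forall>u\<in>S. E v u" using v(2) by (subst S) simp
    then show ?thesis using v(1) by (auto simp: dominated_def dest: core_subsetD)
  next
    case False
    have "E w x" if x: "x \<in> core E S" for x
    proof (cases "E x s")
      case True then show ?thesis using w(2) r(3) x core_subset[of E S] by blast
    next
      case False
      \<comment> \<open>If \<open>x\<close> missed some core vertex, \<open>v\<close> would see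
        properly more of the core than \<open>x\<close>, and \<open>single_corner\<close> would make
        \<open>x\<close> adjacent to \<open>s\<close>.\<close>
      then have "\<forall>y\<in>core E S. E x y"
        using single_corner(1)[OF s x, of v] v core_subset[of E S] by blast
      then show ?thesis using w(1) r(3) by blast
    qed
    then have "\<forall>u\<in>S. E w u" using ws by (subst S) simp
    then show ?thesis using w(1) by (auto simp: dominated_def dest: core_subsetD)
  qed
qed

lemma card_ge_2_of_undominated:
  assumes R: "refl_graph E S" and d: "dominated E (core E S)" "\<not> dominated E S"
  shows "card (S - core E S) \<ge> 2"
proof -
  have "card (S - core E S) \<noteq> 1"
    using dominated_of_single_corner[OF R d(1)] d(2) card_1_singletonE by metis
  moreover have "card (S - core E S) \<noteq> 0"
    using d core_subset[of E S] refl_graphD(1)[OF R] by (metis Diff_eq_empty_iff card_0_eq finite_Diff subset_antisym)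
  ultimately show ?thesis by linarith
qed

text \<open>Every \<open>z\<close> in \<open>T - U\<close> is a corner of \<open>T\<close> but not
  of \<open>S\<close>, so \<open>s\<close> is its private neighbour. The vertex that corners
  \<open>s\<close> therefore sees all of \<open>T - U\<close>; if it lies in \<open>T - U\<close>
  itself, the vertex of \<open>U\<close> that corners it inherits this.\<close>

lemma ex_adjacent_to_previous_class:
  assumes R: "refl_graph E S" and T: "T = core E S" and U: "U = core E T" and s: "S - T = {s}"
  shows "\<exists>u\<in>U. \<forall>z\<in>T - U. E u z"
proof -
  note r = refl_graphD[OF R]
  have RT: "refl_graph E T" using refl_graph_core[OF R] T by simp
  have sS: "s \<in> S" "s \<notin> core E S" using s T by auto
  have zs: "E z s" if zz: "z \<in> T - U" for z
  proof -
    obtain u where "u \<in> U" "\<And>x. x \<in> T \<Longrightarrow> E z x \<Longrightarrow> E u x" "\<exists>x\<in>T. E u x \<and> \<not> E z x"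
      using corner_ex[of T z E] zz refl_graphD(1)[OF RT] U by blast
    then show ?thesis using single_corner(1)[of S E s z u] s T U that core_subset[of E S] core_subset[of E T]
      by blast
  qed
  obtain w where w: "w \<in> T" "\<And>u. u \<in> S \<Longrightarrow> E s u \<Longrightarrow> E w u"
    using corner_ex[OF r(1) sS] T by blast
  have wz: "E w z" if "z \<in> T - U" for z
    using w(2)[of z] zs[OF that] r(3) that T core_subset[of E S] by blast
  show ?thesis
  proof (cases "w \<in> U")
    case True then show ?thesis using wz by blast
  next
    case False
    then obtain u where "u \<in> U" "\<And>x. x \<in> T \<Longrightarrow> E w x \<Longrightarrow> E u x"
      using corner_ex[of T w E] w(1) refl_graphD(1)[OF RT] U by blast
    then show ?thesis using wz by blast
  qed
qed

text \<open>The vertex of the clique \<open>core E (core E S)\<close> that sees the whole class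
  below also sees the clique. So under a top of type 0 the third class from the top has at least two
  vertices.\<close>

lemma dominated_core_of_single_corner:
  assumes R: "refl_graph E S" and c: "is_clique E (core E (core E S))" and s: "S - core E S = {s}"
  shows "dominated E (core E S)"
proof -
  obtain u where u: "u \<in> core E (core E S)" "\<forall>z\<in>core E S - core E (core E S). E u z"
    using ex_adjacent_to_previous_class[OF R refl refl s] by blast
  then have "\<forall>x\<in>core E S. E u x" using c by (auto simp: is_clique_def)
  then show ?thesis using u(1) by (auto simp: dominated_def dest: core_subsetD)
qed

lemma escape:
  assumes "U = core E T" "y \<in> U" "k \<in> T" "\<And>x. x \<in> U \<Longrightarrow> E y x \<Longrightarrow> E k x"
    and "x \<in> T" "E k x" "\<not> E y x"
  shows "\<exists>z\<in>T - U. E y z \<and> \<not> E k z"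
  using noncorner[of y E T k x] assms by blast

text \<open>With \<open>ex_adjacent_to_previous_class\<close> this excludes a class of size 1 three levels below the top.\<close>
lemma no_adjacent_small_single_top:
  assumes R: "refl_graph E T" and U: "U = core E T" and d: "dominated E U" "\<not> dominated E T"
    and K: "core E U = {v}" and c: "card (U - {v}) \<le> 3" and u: "u \<in> U" "\<And>z. z \<in> T - U \<Longrightarrow> E u z"
  shows False
proof -
  note r = refl_graphD[OF R]
  have RU: "refl_graph E U" using refl_graph_core[OF R] U by simp
  have UT: "U \<subseteq> T" using U by (simp add: core_subset)
  have vU: "\<And>x. x \<in> U \<Longrightarrow> E v x" "v \<in> U" using core_dominated[OF RU d(1)] K by auto
  have uv: "u \<noteq> v"
  proof
    assume "u = v"
    then have "\<forall>x\<in>T. E u x" using vU u by blast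
    then show False using d(2) u UT by (auto simp: dominated_def dest: core_subsetD)
  qed
  have dom: "x = v" if "x \<in> U" "\<forall>y\<in>U. E x y" for x
    using dominating_in_core[of x U E] that K by auto
  obtain y2 where y2: "y2 \<in> U" "\<not> E u y2" using dom[of u] uv u by blast
  \<comment> \<open>\<open>v\<close> sees all of \<open>U\<close>, including \<open>u\<close>, which
    \<open>y2\<close> misses. As \<open>v\<close> does not corner \<open>y2\<close> in
    \<open>T\<close>, the vertex \<open>y2\<close> has a private neighbour \<open>z\<close> outside
    \<open>U\<close>.\<close>
  have "\<exists>z\<in>T - U. E y2 z \<and> \<not> E v z"
    by (rule escape[OF U y2(1), of v u]) (use vU UT y2 r(3) u in auto)
  then obtain z where z: "z \<in> T" "z \<notin> U" "E y2 z" "\<not> E v z" by blast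
  obtain y3 where y3: "y3 \<in> U" "\<And>x. x \<in> T \<Longrightarrow> E z x \<Longrightarrow> E y3 x"
    using corner_ex[of T z E] z r(1) U by blast
  have a: "E y3 z" "E y3 y2" "E y3 u"
    using y3(2) z r(2,3) y2(1) u UT by blast+
  have ne: "y3 \<noteq> v" "y3 \<noteq> u" "y3 \<noteq> y2" "y2 \<noteq> u" "y2 \<noteq> v" "u \<noteq> v"
    using a z y2 uv r u(1) UT vU by blast+
  \<comment> \<open>The bound 3 enters here: \<open>u\<close>, \<open>y2\<close>, \<open>y3\<close>
    exhaust \<open>U - {v}\<close>, so \<open>y3\<close> sees all of \<open>U\<close> and would be a
    second dominating vertex.\<close>
  have "{u, y2, y3} \<subseteq> U - {v}" using u y2 y3 ne by auto
  moreover have "finite (U - {v})" using r(1) UT finite_subset by blast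
  moreover have "card {u, y2, y3} = 3" using ne by auto
  ultimately have "U - {v} = {u, y2, y3}" using c card_seteq by metis
  then have "x = v \<or> x = u \<or> x = y2 \<or> x = y3" if "x \<in> U" for x using that by blast
  moreover have "E y3 v" "E y3 y3" using r(3)[OF vU(1)] r(2) y3(1) UT by auto
  ultimately have "\<forall>y\<in>U. E y3 y" using a by metis
  then show False using dom y3(1) ne by blast
qed

text \<open>Let \<open>k1\<close> corner \<open>u\<close>, let \<open>y\<close> be missed by
  \<open>k1\<close>, and let \<open>k2\<close> corner \<open>y\<close>. Then some \<open>z\<close>
  in \<open>T - U\<close> is seen by \<open>u\<close> and \<open>y\<close> but not by
  \<open>k2\<close>, and whatever corners \<open>z\<close> sees both \<open>u\<close> and
  \<open>y\<close>. The size bounds make this vertex dominate \<open>U\<close>, or give three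
  vertices to a clique of two.\<close>

lemma no_adjacent_below_clique_top:
  assumes R: "refl_graph E T" and U: "U = core E T" and K: "K = core E U" and cl: "is_clique E K"
    and d: "\<not> dominated E U" and u: "u \<in> U - K" "\<And>z. z \<in> T - U \<Longrightarrow> E u z"
    and c: "card (U - K) \<le> 2 \<or> card (U - K) \<le> 3 \<and> card K \<le> 2"
  shows False
proof -
  note r = refl_graphD[OF R]
  have RU: "refl_graph E U" using refl_graph_core[OF R] U by simp
  have UT: "U \<subseteq> T" and KU: "K \<subseteq> U" using U K by (simp_all add: core_subset)
  have finU: "finite U" using RU by (auto simp: refl_graph_def)
  have nd: "\<not> (\<forall>y\<in>U. E x y)" if "x \<in> U" for x using d that by (auto simp: dominated_def dest: core_subsetD)
  have KK: "E x y" if "x \<in> K" "y \<in> K" for x y using cl that by (auto simp: is_clique_def)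
  have corn: "\<exists>k\<in>K. (\<forall>x\<in>U. E y x \<longrightarrow> E k x) \<and> (\<exists>x\<in>U. E k x \<and> \<not> E y x)" if "y \<in> U - K" for y
    using corner_ex[OF finU, of y E] that K by blast
  obtain k1 where k1: "k1 \<in> K" "\<And>x. x \<in> U \<Longrightarrow> E u x \<Longrightarrow> E k1 x" using corn u(1) by blast
  obtain y where y: "y \<in> U" "\<not> E k1 y" using nd k1 KU by blast
  then have yK: "y \<in> U - K" using KK k1 by blast
  have uy: "\<not> E u y" using k1 y by blast
  obtain k2 where k2: "k2 \<in> K" "\<And>x. x \<in> U \<Longrightarrow> E y x \<Longrightarrow> E k2 x" "\<exists>x\<in>U. E k2 x \<and> \<not> E y x"
    using corn[OF yK] by blast
  have "\<exists>z\<in>T - U. E y z \<and> \<not> E k2 z"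
    using escape[OF U y(1), of k2] k2 KU UT by blast
  then obtain z where z: "z \<in> T" "z \<notin> U" "E y z" "\<not> E k2 z" by blast
  obtain u' where u': "u' \<in> U" "\<And>x. x \<in> T \<Longrightarrow> E z x \<Longrightarrow> E u' x"
    using corner_ex[of T z E] z r(1) U by blast
  have a: "E u' z" "E u' y" "E u' u"
    using u'(2) z r(2,3) y(1) u UT by blast+
  have ne: "u' \<noteq> u" "u' \<noteq> y" "u \<noteq> y" "u' \<noteq> k1" "u' \<noteq> k2"
    using a uy y z r u(1) UT by blast+
  have k12: "E k2 y" "k1 \<noteq> k2" using k2 y r(2) UT by blast+
  have fin: "finite (U - K)" "finite K" using finU KU finite_subset by blast+
  show False
  proof (cases "u' \<in> K")
    case True
    show ?thesis
    proof (cases "card (U - K) \<le> 2")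
      case True
      have "{u, y} \<subseteq> U - K" "card {u, y} = 2" using u yK ne by auto
      then have "U - K = {u, y}" using True card_seteq[OF fin(1)] by metis
      then have "x \<in> K \<or> x = u \<or> x = y" if "x \<in> U" for x using that by blast
      then show ?thesis using nd[OF u'(1)] a KK[OF \<open>u' \<in> K\<close>] by blast
    next
      case False
      then have "card K \<le> 2" using c by auto
      moreover have "{k1, k2, u'} \<subseteq> K" "card {k1, k2, u'} = 3" using k1 k2 \<open>u' \<in> K\<close> ne k12 by auto
      ultimately show ?thesis using card_mono[OF fin(2), of "{k1, k2, u'}"] by linarith
    qed
  next
    case False
    have s3: "{u, y, u'} \<subseteq> U - K" "card {u, y, u'} = 3" using u yK u'(1) False ne by auto
    then have "card (U - K) \<ge> 3" using card_mono[OF fin(1)] by metis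
    then have c': "card (U - K) \<le> 3" "card K \<le> 2" using c by auto
    have "U - K = {u, y, u'}" using s3 card_seteq[OF fin(1)] c'(1) by metis
    moreover have "{k1, k2} \<subseteq> K" "card {k1, k2} = 2" using k1 k2 k12 by auto
    then have "K = {k1, k2}" using card_seteq[OF fin(2)] c'(2) by metis
    \<comment> \<open>\<open>u'\<close> is a neighbour of \<open>u\<close> and of \<open>y\<close>,
      whose neighbours in \<open>U\<close> are absorbed by \<open>k1\<close> and
      \<open>k2\<close>.\<close>
    moreover have "E u' k1" "E u' k2" using k1(2)[of u'] k2(2)[of u'] a u'(1) r(3) by blast+
    moreover have "x = k1 \<or> x = k2 \<or> x = u \<or> x = y \<or> x = u'" if "x \<in> U" for x
      using that calculation(1,2) by blast
    ultimately have "\<forall>x\<in>U. E u' x" using a r(2) u'(1) UT by blast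
    then show ?thesis using nd u'(1) by blast
  qed
qed

text \<open>Here \<open>u\<close> cannot corner any \<open>y\<close> of \<open>U - K\<close> within
  \<open>U\<close>, because \<open>escape\<close> would give \<open>y\<close> a neighbour in
  \<open>T - U\<close> that \<open>u\<close> misses. With two vertices in \<open>K\<close>, some
  \<open>y\<close> can be cornered only by \<open>u\<close>; with two vertices in
  \<open>U - K\<close>, \<open>u\<close> misses both and is itself cornered by
  \<open>k1\<close>.\<close>

lemma no_adjacent_in_clique_top:
  assumes R: "refl_graph E T" and U: "U = core E T" and K: "K = core E U" and cl: "is_clique E K"
    and d: "\<not> dominated E U" and u: "u \<in> K" "\<And>z. z \<in> T - U \<Longrightarrow> E u z"
    and c: "card (U - K) = 2 \<or> card K = 2"
  shows False
proof -
  note r = refl_graphD[OF R]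
  have RU: "refl_graph E U" using refl_graph_core[OF R] U by simp
  have UT: "U \<subseteq> T" and KU: "K \<subseteq> U" using U K by (simp_all add: core_subset)
  have finU: "finite U" using RU by (auto simp: refl_graph_def)
  have nd: "\<exists>y\<in>U. \<not> E x y" if "x \<in> U" for x using d that by (auto simp: dominated_def dest: core_subsetD)
  have KK: "E x y" if "x \<in> K" "y \<in> K" for x y using cl that by (auto simp: is_clique_def)
  have corn: "\<exists>k\<in>K. (\<forall>x\<in>U. E y x \<longrightarrow> E k x) \<and> (\<exists>x\<in>U. E k x \<and> \<not> E y x)" if "y \<in> U - K" for y
    using corner_ex[OF finU, of y E] that K by blast
  have key: "\<not> ((\<forall>x\<in>U. E y x \<longrightarrow> E u x) \<and> (\<exists>x\<in>U. E u x \<and> \<not> E y x))" if "y \<in> U - K" for y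
    using escape[OF U, of y u] that u KU UT by blast
  show False
  proof (cases "card K = 2")
    case True
    then obtain k where k: "K = {u, k}" "k \<noteq> u" using u(1) by (auto simp: card_2_iff)
    obtain y where y: "y \<in> U" "\<not> E k y" using nd[of k] k KU by auto
    then have yK: "y \<in> U - K" using KK[of k] k by auto
    obtain k' where k': "k' \<in> K" "(\<forall>x\<in>U. E y x \<longrightarrow> E k' x) \<and> (\<exists>x\<in>U. E k' x \<and> \<not> E y x)"
      using corn[OF yK] by blast
    then have "k' \<noteq> k" using y r(2) UT by blast
    then show ?thesis using key[OF yK] k' k by auto
  next
    case False
    then obtain y1 y2 where Y: "U - K = {y1, y2}" "y1 \<noteq> y2" using c by (auto simp: card_2_iff)
    have notboth: "\<not> (E k y1 \<and> E k y2)" if "k \<in> K" for k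
    proof
      assume "E k y1 \<and> E k y2"
      moreover have "x \<in> K \<or> x = y1 \<or> x = y2" if "x \<in> U" for x using Y that by blast
      ultimately have "\<forall>x\<in>U. E k x" using KK[OF that] by blast
      then show False using nd[of k] that KU by blast
    qed
    have y1: "y1 \<in> U - K" "y2 \<in> U - K" using Y by auto
    have refl: "E y1 y1" "E y2 y2" using y1 r(2) UT by auto
    obtain k1 where k1: "k1 \<in> K" "\<forall>x\<in>U. E y1 x \<longrightarrow> E k1 x" using corn[OF y1(1)] by blast
    obtain k2 where k2: "k2 \<in> K" "\<forall>x\<in>U. E y2 x \<longrightarrow> E k2 x" using corn[OF y1(2)] by blast
    have a: "E k1 y1" "E k2 y2" "\<not> E k1 y2" "\<not> E k2 y1" using k1 k2 y1 refl notboth by blast+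
    have "\<not> E y1 y2" "\<not> E y2 y1" using k1 a y1 r(3) by blast+
    moreover have "\<not> E y1 k2" "\<not> E y2 k1" using a r(3) by blast+
    ultimately have nE: "\<not> E y1 y2" "\<not> E y2 y1" "\<not> E y1 k2" "\<not> E y2 k1" by auto
    have U3: "x \<in> K \<or> x = y1 \<or> x = y2" if "x \<in> U" for x using Y that by blast
    have k12: "k1 \<in> U" "k2 \<in> U" "E u k1" "E u k2" using KK[OF u(1)] k1(1) k2(1) KU by auto
    have n: "\<not> E u y1"
    proof
      assume "E u y1"
      then have "\<forall>x\<in>U. E y1 x \<longrightarrow> E u x" using U3 KK[OF u(1)] nE by metis
      then show False using key[OF y1(1)] k12 nE by blast
    qed
    have n2: "\<not> E u y2"
    proof
      assume "E u y2"
      then have "\<forall>x\<in>U. E y2 x \<longrightarrow> E u x" using U3 KK[OF u(1)] nE by metis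
      then show False using key[OF y1(2)] k12 nE by blast
    qed
    have "\<And>x. x \<in> U \<Longrightarrow> E u x \<Longrightarrow> E k1 x" using n n2 U3 KK[OF k1(1)] by metis
    then have "E u y1" using noncorner[of u E U k1 y1] u(1) K k12(1) y1 a(1) by auto
    then show ?thesis using n by simp
  qed
qed

lemma no_adjacent_small_clique_top:
  assumes R: "refl_graph E T" and U: "U = core E T" and K: "K = core E U" and cl: "is_clique E K"
    and d: "\<not> dominated E U" and u: "u \<in> U" "\<And>z. z \<in> T - U \<Longrightarrow> E u z"
    and c: "card (U - K) = 2 \<or> card (U - K) = 3 \<and> card K = 2"
  shows False
  using no_adjacent_below_clique_top[OF R U K cl d, of u] no_adjacent_in_clique_top[OF R U K cl d, of u]
    u c by fastforce

text \<open>A core with a single vertex would corner every other vertex from there, and this vertex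
  would dominate \<open>S\<close>.\<close>

lemma clique_core_card:
  assumes R: "refl_graph E S" and c: "is_clique E (core E S)" and d: "\<not> dominated E S"
  shows "card (core E S) \<ge> 2" "card (S - core E S) \<ge> 2"
proof -
  note r = refl_graphD[OF R]
  have RC: "refl_graph E (core E S)" using refl_graph_core[OF R] .
  show "card (S - core E S) \<ge> 2"
    using card_ge_2_of_undominated[OF R] dominated_clique[OF RC c] d by blast
  have "card (core E S) \<noteq> 1"
  proof
    assume "card (core E S) = 1"
    then obtain v where v: "core E S = {v}" using card_1_singletonE by blast
    have "E v x" if "x \<in> S" for x
    proof (cases "x \<in> core E S")
      case True then show ?thesis using v r(2) that by auto
    next
      case False
      then obtain w where "w \<in> core E S" "\<forall>u\<in>S. E x u \<longrightarrow> E w u"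
        using corner_ex[OF r(1) \<open>x \<in> S\<close>] by blast
      then show ?thesis using v r(2)[OF that] that by simp
    qed
    then show False using d v core_subset[of E S] by (auto simp: dominated_def dest: core_subsetD)
  qed
  moreover have "card (core E S) \<noteq> 0" using RC by (auto simp: refl_graph_def)
  ultimately show "card (core E S) \<ge> 2" by linarith
qed

section \<open>Paths\<close>

text \<open>Equal indices are allowed, which accounts for the loops. \<open>E\<close> may live on a
  larger set, so one relation serves the paths at all levels of a graph.\<close>

definition path_on :: "('a \<Rightarrow> 'a \<Rightarrow> bool) \<Rightarrow> 'a set \<Rightarrow> nat \<Rightarrow> (nat \<Rightarrow> 'a) \<Rightarrow> bool" where
  "path_on E S n f \<longleftrightarrow> bij_betw f {0..<n} S \<and>
     (\<forall>i<n. \<forall>j<n. E (f i) (f j) \<longleftrightarrow> i \<le> j + 1 \<and> j \<le> i + 1)"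

lemma graph_isoI:
  assumes "bij_betw f W V" "\<And>x y. x \<in> W \<Longrightarrow> y \<in> W \<Longrightarrow> F x y \<longleftrightarrow> E (f x) (f y)"
  shows "graph_iso V E W F"
proof -
  let ?g = "inv_into W f"
  have g: "bij_betw ?g V W" by (rule bij_betw_inv_into[OF assms(1)])
  have "E x y \<longleftrightarrow> F (?g x) (?g y)" if "x \<in> V" "y \<in> V" for x y
    using assms(2)[of "?g x" "?g y"] that bij_betwE[OF g] bij_betw_inv_into_right[OF assms(1)] by simp
  then show ?thesis using g unfolding graph_iso_def by blast
qed

lemma graph_iso_path_iff: "graph_iso V E (path_V n) (path_E n) \<longleftrightarrow> (\<exists>f. path_on E V n f)"
proof
  assume "graph_iso V E (path_V n) (path_E n)"
  then obtain h where h: "bij_betw h V (path_V n)"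
      "\<And>x y. x \<in> V \<Longrightarrow> y \<in> V \<Longrightarrow> E x y \<longleftrightarrow> path_E n (h x) (h y)"
    by (auto simp: graph_iso_def)
  let ?f = "inv_into V h"
  have f: "bij_betw ?f (path_V n) V" by (rule bij_betw_inv_into[OF h(1)])
  have "E (?f i) (?f j) \<longleftrightarrow> path_E n i j" if "i < n" "j < n" for i j
    using h(2)[of "?f i" "?f j"] that bij_betwE[OF f] bij_betw_inv_into_right[OF h(1)]
    by (auto simp: path_V_def)
  then show "\<exists>f. path_on E V n f"
    using f by (intro exI[of _ ?f]) (auto simp: path_on_def path_V_def path_E_def)
next
  assume "\<exists>f. path_on E V n f"
  then obtain f where "path_on E V n f" ..
  then show "graph_iso V E (path_V n) (path_E n)"
    by (intro graph_isoI[of f]) (auto simp: path_on_def path_V_def path_E_def)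
qed

text \<open>\<open>b\<close> does not corner the end \<open>a\<close> although it sees the further
  vertex \<open>c\<close>, so \<open>a\<close> has a neighbour \<open>s\<close> that
  \<open>b\<close> misses, and \<open>s\<close> lies outside \<open>T\<close>. A vertex of
  \<open>T\<close> that corners \<open>s\<close> sees both \<open>a\<close> and \<open>s\<close>,
  which leaves only \<open>a\<close>.\<close>

lemma path_end_extends:
  assumes R: "refl_graph E S" and T: "T = core E S" and ab: "a \<in> T" "b \<in> T" "c \<in> T"
    and Na: "\<And>x. x \<in> T \<Longrightarrow> E a x \<Longrightarrow> x = a \<or> x = b" and E: "E a b" "E b c" "\<not> E a c"
  shows "\<exists>s\<in>S - T. E a s \<and> \<not> E b s \<and> (\<forall>x\<in>S. E s x \<longrightarrow> E a x)"
proof -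
  note r = refl_graphD[OF R]
  have TS: "T \<subseteq> S" using T by (simp add: core_subset)
  obtain s where s: "s \<in> S" "E a s" "\<not> E b s"
    using noncorner[of a E S b c] ab E T TS by blast
  then have sT: "s \<notin> T" using Na[of s] E r(2,3) ab TS by blast
  obtain t where t: "t \<in> T" "\<forall>x\<in>S. E s x \<longrightarrow> E t x"
    using corner_ex[of S s E] s sT r(1) T by blast
  have "E t a" "E t s" using t s r TS ab by blast+
  then have "t = a" using Na[of t] r(3) s t(1) by blast
  then show ?thesis using s sT t by blast
qed

text \<open>Each end acquires a new neighbour that meets the old path nowhere else. The bound
  \<open>n \<ge> 3\<close> supplies the vertex at distance two from each end that
  \<open>path_end_extends\<close> needs.\<close>

lemma path_extend:
  assumes R: "refl_graph E S" and P: "path_on E (core E S) n f" and n: "n \<ge> 3"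
  shows "card (S - core E S) \<ge> 2"
    and "card (S - core E S) = 2 \<Longrightarrow> \<exists>g. path_on E S (n + 2) g"
proof -
  define T where "T = core E S"
  note r = refl_graphD[OF R]
  have TS: "T \<subseteq> S" by (simp add: T_def core_subset)
  have bij: "bij_betw f {0..<n} T" and adj: "\<And>i j. i < n \<Longrightarrow> j < n \<Longrightarrow> E (f i) (f j) \<longleftrightarrow> i \<le> j + 1 \<and> j \<le> i + 1"
    using P by (auto simp: path_on_def T_def)
  have fT: "f i \<in> T" if "i < n" for i using bij_betwE[OF bij] that by auto
  have Tf: "\<exists>i<n. x = f i" if "x \<in> T" for x
    using bij that by (auto simp: bij_betw_def)
  have inj: "f i = f j \<longleftrightarrow> i = j" if "i < n" "j < n" for i j
    using bij that by (auto simp: bij_betw_def inj_on_def)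
  have "\<exists>s\<in>S - T. E (f 0) s \<and> \<not> E (f 1) s \<and> (\<forall>x\<in>S. E s x \<longrightarrow> E (f 0) x)"
  proof (rule path_end_extends[OF R T_def, of _ _ "f 2"])
    show "x = f 0 \<or> x = f 1" if x: "x \<in> T" "E (f 0) x" for x
    proof -
      obtain i where "i < n" "x = f i" using Tf x by blast
      then have "i \<le> 1" using adj[of 0 i] x(2) n by auto
      then show ?thesis using \<open>x = f i\<close> by (cases i) auto
    qed
  qed (use n fT adj in auto)
  then obtain s0 where s0: "s0 \<in> S" "s0 \<notin> T" "E (f 0) s0" "\<not> E (f 1) s0" "\<And>x. x\<in>S \<Longrightarrow> E s0 x \<Longrightarrow> E (f 0) x"
    by blast
  have "\<exists>s\<in>S - T. E (f (n-1)) s \<and> \<not> E (f (n-2)) s \<and> (\<forall>x\<in>S. E s x \<longrightarrow> E (f (n-1)) x)"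
  proof (rule path_end_extends[OF R T_def, of _ _ "f (n-3)"])
    show "x = f (n-1) \<or> x = f (n-2)" if x: "x \<in> T" "E (f (n-1)) x" for x
    proof -
      obtain i where "i < n" "x = f i" using Tf x by blast
      then have "i = n-1 \<or> i = n-2" using adj[of "n-1" i] x(2) n by auto
      then show ?thesis using \<open>x = f i\<close> by auto
    qed
  qed (use n fT adj in auto)
  then obtain s1 where s1: "s1 \<in> S" "s1 \<notin> T" "E (f (n-1)) s1" "\<not> E (f (n-2)) s1"
      "\<And>x. x\<in>S \<Longrightarrow> E s1 x \<Longrightarrow> E (f (n-1)) x"
    by blast
  have s0T: "E s0 (f i) \<longleftrightarrow> i = 0" if "i < n" for i
  proof
    assume a: "E s0 (f i)"
    then have "E (f 0) (f i)" using s0(5)[of "f i"] fT[OF that] TS by blast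
    then have "i \<le> 1" using adj[of 0 i] that n by auto
    moreover have "i \<noteq> 1" using a s0(4) r(3) by blast
    ultimately show "i = 0" by simp
  qed (use s0 r(3) in auto)
  have s1T: "E s1 (f i) \<longleftrightarrow> i = n - 1" if "i < n" for i
  proof
    assume a: "E s1 (f i)"
    then have "E (f (n-1)) (f i)" using s1(5)[of "f i"] fT[OF that] TS by blast
    then have "i = n-1 \<or> i = n-2" using adj[of "n-1" i] that n by auto
    moreover have "i \<noteq> n-2" using a s1(4) r(3) by blast
    ultimately show "i = n-1" by simp
  qed (use s1 r(3) in auto)
  \<comment> \<open>Since \<open>f 0\<close> absorbs the neighbours of \<open>s0\<close>, such an
    edge would join \<open>s1\<close> to the wrong end of the path.\<close>
  have ns: "\<not> E s0 s1"
  proof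
    assume "E s0 s1"
    then have "E s1 (f 0)" using s0(5)[of s1] s1(1) r(3) by blast
    then show False using s1T[of 0] n by auto
  qed
  then have ne: "s0 \<noteq> s1" using r(2) s0(1) by blast
  have fin: "finite (S - core E S)" using r(1) by simp
  have sub: "{s0, s1} \<subseteq> S - core E S" using s0 s1 by (auto simp: T_def)
  show "card (S - core E S) \<ge> 2" using card_mono[OF fin sub] ne by simp
  show "\<exists>g. path_on E S (n + 2) g" if c: "card (S - core E S) = 2"
  proof -
    have "{s0, s1} = S - core E S" using card_seteq[OF fin sub] c ne by simp
    then have S: "S = insert s0 (insert s1 T)" using TS by (auto simp: T_def)
    define g where "g i = (if i = 0 then s0 else if i = n + 1 then s1 else f (i - 1))" for i
    have im: "g ` {0..<n+2} = S"
    proof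
      show "g ` {0..<n+2} \<subseteq> S" using fT by (auto simp: g_def S)
      show "S \<subseteq> g ` {0..<n+2}"
      proof
        fix x assume "x \<in> S"
        then consider "x = s0" | "x = s1" | "x \<in> T" using S by auto
        then show "x \<in> g ` {0..<n+2}"
        proof cases
          case 1 then show ?thesis by (intro image_eqI[of _ _ 0]) (auto simp: g_def)
        next
          case 2 then show ?thesis by (intro image_eqI[of _ _ "n+1"]) (auto simp: g_def)
        next
          case 3
          then obtain i where "i < n" "x = f i" using Tf by blast
          then show ?thesis by (intro image_eqI[of _ _ "i+1"]) (auto simp: g_def)
        qed
      qed
    qed
    have "card T = n" using bij_betw_same_card[OF bij] by simp
    moreover have "finite T" using TS r(1) finite_subset by blast
    ultimately have "card S = n + 2" using S ne s0 s1 by simp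
    then have inj: "inj_on g {0..<n+2}" using eq_card_imp_inj_on[of "{0..<n+2}" g] im by simp
    have E1: "E (f i) s0 \<longleftrightarrow> i = 0" "E (f i) s1 \<longleftrightarrow> i = n - 1" if "i < n" for i
      using s0T[OF that] s1T[OF that] r(3) by blast+
    have "E (g i) (g j) \<longleftrightarrow> i \<le> j + 1 \<and> j \<le> i + 1" if hi: "i < n + 2" and hj: "j < n + 2" for i j
    proof -
      have si: "E s0 s0" "E s1 s1" "\<not> E s1 s0" using r ns s0(1) s1(1) by blast+
      consider "i = 0" | "i = n + 1" | i' where "i = Suc i'" "i' < n"
        using hi by (cases i) (auto simp: less_Suc_eq)
      then show ?thesis
      proof cases
        case 1
        consider "j = 0" | "j = n + 1" | j' where "j = Suc j'" "j' < n"
          using hj by (cases j) (auto simp: less_Suc_eq)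
        then show ?thesis by cases (use 1 n ns si s0T in \<open>auto simp: g_def\<close>)
      next
        case 2
        consider "j = 0" | "j = n + 1" | j' where "j = Suc j'" "j' < n"
          using hj by (cases j) (auto simp: less_Suc_eq)
        then show ?thesis by cases (use 2 n ns si s1T in \<open>auto simp: g_def\<close>)
      next
        case 3
        consider "j = 0" | "j = n + 1" | j' where "j = Suc j'" "j' < n"
          using hj by (cases j) (auto simp: less_Suc_eq)
        then show ?thesis by cases (use 3 n E1 adj in \<open>auto simp: g_def\<close>)
      qed
    qed
    then have "path_on E S (n + 2) g" using inj im by (auto simp: path_on_def bij_betw_def)
    then show ?thesis by blast
  qed
qed

text \<open>The seed for the paths of odd order, where the core is too small for
  \<open>path_extend\<close>. The two removed vertices are nonadjacent, or \<open>y1\<close> would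
  dominate.\<close>

lemma path3:
  assumes R: "refl_graph E S" and d: "dominated E S" "\<not> is_clique E S" and c: "card (core E S) = 1"
    "card (S - core E S) = 2"
  shows "\<exists>f. path_on E S 3 f"
proof -
  note r = refl_graphD[OF R]
  obtain v where v: "core E S = {v}" using c(1) card_1_singletonE by blast
  obtain y1 y2 where Y: "S - core E S = {y1, y2}" "y1 \<noteq> y2" using c(2) by (auto simp: card_2_iff)
  have S: "S = {y1, v, y2}" using Y v core_subset[of E S] by auto
  have ne: "y1 \<noteq> v" "y2 \<noteq> v" using Y v by auto
  have mem: "y1 \<in> S" "v \<in> S" "y2 \<in> S" using S by auto
  have dm: "x = v" if "x \<in> S" "\<forall>u\<in>S. E x u" for x
    using dominating_in_core[of x S E] that v by auto
  have "\<forall>u\<in>S. E v u" using d(1) dm by (auto simp: dominated_def)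
  then have vE: "E v y1" "E v y2" "E v v" using mem by auto
  have n: "\<not> E y1 y2"
  proof
    assume "E y1 y2"
    then have "\<forall>u\<in>{y1, v, y2}. E y1 u" using r(3)[OF vE(1)] r(2)[OF mem(1)] by simp
    then have "\<forall>u\<in>S. E y1 u" by (subst S)
    then show False using dm[OF mem(1)] ne(1) by blast
  qed
  have sy: "E y1 v" "E y2 v" "\<not> E y2 y1" "E y1 y1" "E y2 y2" using r(3) vE n r(2) mem by blast+
  let ?l = "[y1, v, y2]"
  have "bij_betw ((!) ?l) {0..<3} S"
    by (intro bij_betw_nth) (simp_all add: ne ne[symmetric] Y(2) S lessThan_atLeast0 numeral_eq_Suc)
  moreover have "E (?l ! i) (?l ! j) \<longleftrightarrow> i \<le> j + 1 \<and> j \<le> i + 1" if "i < 3" "j < 3" for i j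
    using that vE n sy by (auto simp: less_Suc_eq numeral_eq_Suc)
  ultimately have "path_on E S 3 ((!) ?l)" by (simp add: path_on_def)
  then show ?thesis by blast
qed

text \<open>The seed for the paths of even order. The two corners hang on different clique vertices,
  since a clique vertex that sees both would dominate.\<close>

lemma path4:
  assumes R: "refl_graph E S" and d: "\<not> dominated E S" "is_clique E (core E S)" and c: "card (core E S) = 2"
    "card (S - core E S) = 2"
  shows "\<exists>f. path_on E S 4 f"
proof -
  note r = refl_graphD[OF R]
  obtain k0 k0' where K0: "core E S = {k0, k0'}" "k0 \<noteq> k0'" using c(1) by (auto simp: card_2_iff)
  obtain y1 y2 where Y: "S - core E S = {y1, y2}" "y1 \<noteq> y2" using c(2) by (auto simp: card_2_iff)
  have S: "S = {y1, y2} \<union> core E S" using Y core_subset[of E S] by auto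
  have yS: "y1 \<in> S" "y2 \<in> S" "y1 \<notin> core E S" "y2 \<notin> core E S" using Y by auto
  obtain k1 where k1: "k1 \<in> core E S" "\<forall>u\<in>S. E y1 u \<longrightarrow> E k1 u" using corner_ex[OF r(1) yS(1,3)] by blast
  obtain k2 where k2: "k2 \<in> core E S" "\<forall>u\<in>S. E y2 u \<longrightarrow> E k2 u" using corner_ex[OF r(1) yS(2,4)] by blast
  have a: "E k1 y1" "E k2 y2" using k1 k2 r(2) yS by blast+
  have nb: "\<not> (E k y1 \<and> E k y2)" if "k \<in> core E S" for k
  proof
    assume "E k y1 \<and> E k y2"
    then have "\<forall>u\<in>{y1, y2} \<union> core E S. E k u" using d(2) that by (auto simp: is_clique_def)
    then have "\<forall>u\<in>S. E k u" by (subst S)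
    then show False using d(1) core_subsetD[OF that] by (auto simp: dominated_def)
  qed
  have n: "\<not> E k1 y2" "\<not> E k2 y1" "k1 \<noteq> k2" using nb a k1 k2 by blast+
  then have K: "core E S = {k1, k2}" using K0 k1 k2 by auto
  have kk: "E k1 k2" "E k2 k1" "E k1 k1" "E k2 k2" using d(2) k1 k2 by (auto simp: is_clique_def)
  have ny: "\<not> E y1 y2" using k1 n yS by blast
  have ne: "y1 \<noteq> k1" "y1 \<noteq> k2" "y2 \<noteq> k1" "y2 \<noteq> k2" using yS K by auto
  have neg: "\<not> E y2 k1" "\<not> E y1 k2" "\<not> E y2 y1" using n ny r(3) by blast+
  have sy: "E y1 k1" "E y2 k2" "E y1 y1" "E y2 y2" using a r yS by blast+
  let ?l = "[y1, k1, k2, y2]"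
  have "S = set ?l" using S K by auto
  moreover have "distinct ?l" using ne n(3) Y(2) by simp
  ultimately have "bij_betw ((!) ?l) {0..<4} S"
    by (intro bij_betw_nth) (simp_all add: lessThan_atLeast0 numeral_eq_Suc)
  moreover have "E (?l ! i) (?l ! j) \<longleftrightarrow> i \<le> j + 1 \<and> j \<le> i + 1" if "i < 4" "j < 4" for i j
    using that neg sy ny kk n a by (auto simp: less_Suc_eq numeral_eq_Suc)
  ultimately have "path_on E S 4 ((!) ?l)" by (simp add: path_on_def)
  then show ?thesis by blast
qed

section \<open>The graph H_7\<close>

text \<open>The 14 edges and 7 non-edges listed account for all 21 pairs of distinct
  vertices.\<close>

lemma H7_of_adjacencies:
  assumes S: "S = set [a1, a2, b1, b2, c1, c2, d]" "distinct [a1, a2, b1, b2, c1, c2, d]"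
    and r: "\<And>x. x \<in> S \<Longrightarrow> E x x" "\<And>x y. E x y \<Longrightarrow> E y x"
    and pos: "E a1 a2" "E a1 b1" "E a1 b2" "E a2 b1" "E a2 b2" "E a2 c1" "E a1 c2"
      "E b1 c1" "E b1 c2" "E b2 c1" "E b2 c2" "E b1 d" "E c1 d" "E c2 d"
    and neg: "\<not> E b1 b2" "\<not> E a1 c1" "\<not> E a2 c2" "\<not> E c1 c2" "\<not> E b2 d" "\<not> E a1 d" "\<not> E a2 d"
  shows "graph_iso S E H7_V H7_E"
proof -
  let ?l = "[a1, a2, b1, b2, c1, c2, d]"
  have "bij_betw ((!) ?l) H7_V S"
    using S by (intro bij_betw_nth) (simp_all add: H7_V_def lessThan_atLeast0 numeral_eq_Suc)
  moreover have "H7_E i j \<longleftrightarrow> E (?l ! i) (?l ! j)" if "i \<in> H7_V" "j \<in> H7_V" for i j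
  proof -
    have refl: "E a1 a1" "E a2 a2" "E b1 b1" "E b2 b2" "E c1 c1" "E c2 c2" "E d d"
      using r(1) S(1) by auto
    have neg': "\<not> E b2 b1" "\<not> E c1 a1" "\<not> E c2 a2" "\<not> E c2 c1" "\<not> E d b2" "\<not> E d a1" "\<not> E d a2"
      using neg r(2) by blast+
    note pos' = pos[THEN r(2)]
    have "i = 0 \<or> i = 1 \<or> i = 2 \<or> i = 3 \<or> i = 4 \<or> i = 5 \<or> i = 6"
      "j = 0 \<or> j = 1 \<or> j = 2 \<or> j = 3 \<or> j = 4 \<or> j = 5 \<or> j = 6"
      using that by (auto simp: H7_V_def)
    then show ?thesis
      by (elim disjE) (simp_all add: H7_E_def H7_edges_def H7_V_def refl pos pos' neg neg')
  qed
  ultimately show ?thesis by (rule graph_isoI)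
qed

text \<open>The adjacencies are forced class by class: \<open>K\<close> becomes the pair
  \<open>a1\<close>, \<open>a2\<close>, \<open>U - K\<close> the pair \<open>b1\<close>,
  \<open>b2\<close>, and \<open>T - U\<close> the pair \<open>c1\<close>, \<open>c2\<close>. What
  remains open is only which vertex of \<open>U - K\<close> plays \<open>b1\<close>, the one
  adjacent to \<open>d\<close>.\<close>

lemma H7_unique:
  assumes R: "refl_graph E S" and T: "T = core E S" and U: "U = core E T" and K: "K = core E U"
    and d: "dominated E U" "\<not> dominated E T"
    and c: "card K = 2" "card (U - K) = 2" "card (T - U) = 2" "S - T = {d}"
  shows "graph_iso S E H7_V H7_E"
proof -
  note r = refl_graphD[OF R]
  have RT: "refl_graph E T" using refl_graph_core[OF R] T by simp
  have RU: "refl_graph E U" using refl_graph_core[OF RT] U by simp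
  have sub: "T \<subseteq> S" "U \<subseteq> T" "K \<subseteq> U" by (simp_all add: T U K core_subset)
  have fin: "finite T" "finite U" using RT RU by (auto simp: refl_graph_def)
  have KD: "E a x" if "a \<in> K" "x \<in> U" for a x using core_dominated[OF RU d(1)] that K by simp
  have dK: "x \<in> K" if "x \<in> U" "\<forall>u\<in>U. E x u" for x using dominating_in_core[of x U E] that K by simp
  have dS: "d \<in> S" "d \<notin> T" using c(4) by auto
  obtain u where u: "u \<in> U" "\<And>z. z \<in> T - U \<Longrightarrow> E u z"
    using ex_adjacent_to_previous_class[OF R T U c(4)] by blast
  have uK: "u \<notin> K"
  proof
    assume "u \<in> K"
    then have "\<forall>x\<in>T. E u x" using KD u(2) by blast
    then show False using d(2) u(1) sub by (auto simp: dominated_def)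
  qed
  obtain b' where b': "U - K = {u, b'}" "u \<noteq> b'"
  proof -
    obtain p q where pq: "U - K = {p, q}" "p \<noteq> q" using c(2) by (auto simp: card_2_iff)
    then have "u = p \<or> u = q" using u(1) uK by blast
    then show ?thesis using that[of q] that[of p] pq by auto
  qed
  have bU: "u \<in> U" "b' \<in> U" "b' \<notin> K" using b' u by auto
  have Um: "x \<in> K \<or> x = u \<or> x = b'" if "x \<in> U" for x using b'(1) that by blast
  have nb: "\<not> E u b'"
  proof
    assume "E u b'"
    moreover have "E u u" using r(2) bU(1) sub by blast
    moreover have "E u a" if "a \<in> K" for a using KD[OF that bU(1)] r(3) by blast
    ultimately have "\<forall>x\<in>U. E u x" using Um by metis
    then show False using dK bU(1) uK by blast
  qed
  \<comment> \<open>\<open>a\<close> sees all of \<open>U\<close>, while \<open>b'\<close> misses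
    \<open>u\<close>. As \<open>a\<close> does not corner \<open>b'\<close> in \<open>T\<close>, it
    misses some neighbour of \<open>b'\<close> outside \<open>U\<close>.\<close>
  have esc: "\<exists>z\<in>T - U. E b' z \<and> \<not> E a z" if "a \<in> K" for a
    by (rule escape[OF U bU(2), of a u]) (use KD that sub bU nb r(3) in auto)
  have cor: "\<exists>v\<in>U. (\<forall>x\<in>T. E z x \<longrightarrow> E v x) \<and> (\<exists>x\<in>T. E v x \<and> \<not> E z x)" if "z \<in> T - U" for z
    using corner_ex[of T z E] fin that U by blast
  \<comment> \<open>Whatever corners such a \<open>z\<close> sees the nonadjacent vertices
    \<open>u\<close> and \<open>b'\<close>, hence lies in \<open>K\<close>; it misses
    \<open>d\<close> by \<open>single_corner\<close>.\<close>
  have key: "\<exists>a\<in>K. (\<forall>x\<in>T. E z x \<longrightarrow> E a x) \<and> \<not> E a d" if z: "z \<in> T - U" "E b' z" for z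
  proof -
    obtain v where v: "v \<in> U" "\<forall>x\<in>T. E z x \<longrightarrow> E v x" "\<exists>x\<in>T. E v x \<and> \<not> E z x"
      using cor z(1) by blast
    have "E v u" "E v b'" using v(2) u(2)[OF z(1)] z(2) r(3) bU sub by blast+
    then have "v \<noteq> u" "v \<noteq> b'" using nb r(3) by blast+
    then have "v \<in> K" using Um v(1) by blast
    moreover have "\<not> E v d"
      using single_corner(2)[of S E d z v] c(4) T z(1) v sub by blast
    ultimately show ?thesis using v(2) by blast
  qed
  have zd: "E z d" if z: "z \<in> T - U" for z
  proof -
    obtain v where v: "v \<in> U" "\<forall>x\<in>T. E z x \<longrightarrow> E v x" "\<exists>x\<in>T. E v x \<and> \<not> E z x"
      using cor z(1) by blast
    then show ?thesis using single_corner(1)[of S E d z v] c(4) T z sub by blast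
  qed
  obtain p q where K2: "K = {p, q}" "p \<noteq> q" using c(1) by (auto simp: card_2_iff)
  have pqK: "p \<in> K" "q \<in> K" using K2 by auto
  obtain c1 where c1: "c1 \<in> T - U" "E b' c1" "\<not> E p c1" using esc pqK by blast
  obtain c2 where c2: "c2 \<in> T - U" "E b' c2" "\<not> E q c2" using esc pqK by blast
  have k1: "(\<forall>x\<in>T. E c1 x \<longrightarrow> E q x) \<and> \<not> E q d"
  proof -
    obtain a where a: "a \<in> K" "\<forall>x\<in>T. E c1 x \<longrightarrow> E a x" "\<not> E a d" using key[OF c1(1,2)] by blast
    then have "a \<noteq> p" using c1 r(2) sub by blast
    then show ?thesis using a K2 by blast
  qed
  have k2: "(\<forall>x\<in>T. E c2 x \<longrightarrow> E p x) \<and> \<not> E p d"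
  proof -
    obtain a where a: "a \<in> K" "\<forall>x\<in>T. E c2 x \<longrightarrow> E a x" "\<not> E a d" using key[OF c2(1,2)] by blast
    then have "a \<noteq> q" using c2 r(2) sub by blast
    then show ?thesis using a K2 by blast
  qed
  have cT: "c1 \<in> T" "c2 \<in> T" "c1 \<notin> U" "c2 \<notin> U" using c1 c2 by auto
  have qc: "E q c1" "E p c2" using k1 k2 r(2) cT sub by blast+
  then have cc: "c1 \<noteq> c2" using c1 by blast
  have ncc: "\<not> E c1 c2" using k1 c2(3) cT by blast
  have fTU: "finite (T - U)" using fin by simp
  have Z: "{c1, c2} = T - U"
    using card_seteq[OF fTU, of "{c1, c2}"] c(3) cc c1(1) c2(1) by simp
  obtain w where w: "w \<in> T" "\<forall>x\<in>S. E d x \<longrightarrow> E w x"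
    using corner_ex[of S d E] dS r(1) T by blast
  have wc: "E w c1" "E w c2" "E w d"
    using w(2) zd[OF c1(1)] zd[OF c2(1)] r(2)[OF dS(1)] r(3) cT sub dS by blast+
  have "w \<noteq> p" "w \<noteq> q" "w \<noteq> c1" "w \<noteq> c2" using wc k1 k2 ncc r(3) by blast+
  then have wb: "w = u \<or> w = b'" using w(1) Um[of w] K2(1) Z by blast
  \<comment> \<open>\<open>w\<close> absorbs the neighbours of \<open>d\<close>, so it would see
    both \<open>u\<close> and \<open>b'\<close>, although it is one of these two nonadjacent
    vertices.\<close>
  have notboth: "\<not> (E u d \<and> E b' d)"
  proof
    assume "E u d \<and> E b' d"
    then have "E w u" "E w b'" using w(2) r(3) bU sub by blast+
    then show False using wb nb r(3) by blast
  qed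
  have "S = insert d ((T - U) \<union> (U - K) \<union> K)" using c(4) sub by blast
  also have "\<dots> = insert d ({c1, c2} \<union> {u, b'} \<union> {p, q})" by (simp only: Z b'(1) flip: K2(1))
  finally have S: "S = {d, c1, c2, u, b', p, q}" by auto
  have S': "S = set [p, q, u, b', c1, c2, d]" and S'': "S = set [p, q, b', u, c1, c2, d]"
    using S by auto
  have dist: "distinct [p, q, u, b', c1, c2, d]"
    using K2(2) uK bU b'(2) cT cc dS(2) sub pqK by auto
  then have dist': "distinct [p, q, b', u, c1, c2, d]" by auto
  have pq: "E p q" "E p u" "E p b'" "E q u" "E q b'" using KD pqK bU sub by blast+
  have uc: "E u c1" "E u c2" using u(2) c1 c2 by blast+
  have dd: "E c1 d" "E c2 d" using zd c1 c2 by blast+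
  have nd: "\<not> E p d" "\<not> E q d" using k1 k2 by auto
  show ?thesis
  proof (cases "w = u")
    case True
    then have a: "E u d" "\<not> E b' d" using wc notboth by auto
    show ?thesis
      by (intro H7_of_adjacencies[OF S' dist r(2) r(3)]) (simp_all add: a pq uc dd nd nb c1 c2 qc ncc)
  next
    case False
    then have a: "E b' d" "\<not> E u d" using wb wc notboth by auto
    have nb': "\<not> E b' u" using nb r(3) by blast
    show ?thesis
      by (intro H7_of_adjacencies[OF S'' dist' r(2) r(3)]) (simp_all add: a pq uc dd nd nb' c1 c2 qc ncc)
  qed
qed

section \<open>Capture times of paths and of H_7 with a tail\<close>

lemma cop_wins_iso:
  assumes G: "graph V E" "graph W F" and f: "bij_betw f V W" "\<forall>x\<in>V. \<forall>y\<in>V. E x y \<longleftrightarrow> F (f x) (f y)"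
  shows "c \<in> V \<Longrightarrow> r \<in> V \<Longrightarrow> cop_wins F k (f c) (f r) \<longleftrightarrow> cop_wins E k c r"
proof (induction k arbitrary: c r)
  case 0
  then show ?case using f(1) by (auto simp: bij_betw_def inj_on_def)
next
  case (Suc k)
  have inj: "f x = f y \<longleftrightarrow> x = y" if "x \<in> V" "y \<in> V" for x y
    using f(1) that by (auto simp: bij_betw_def inj_on_def)
  have im: "f ` V = W" using f(1) by (simp add: bij_betw_def)
  have allF: "(\<forall>y. F (f x) y \<longrightarrow> P y) \<longleftrightarrow> (\<forall>y\<in>V. E x y \<longrightarrow> P (f y))" if "x \<in> V" for x P
    using that f(2) G(2) im unfolding graph_def by (metis imageE image_eqI)
  have allE: "(\<forall>y. E x y \<longrightarrow> P y) \<longleftrightarrow> (\<forall>y\<in>V. E x y \<longrightarrow> P y)" for x P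
    using G(1) unfolding graph_def by metis
  have exF: "(\<exists>y. F (f x) y \<and> P y) \<longleftrightarrow> (\<exists>y\<in>V. E x y \<and> P (f y))" if "x \<in> V" for x P
    using allF[OF that, of "\<lambda>y. \<not> P y"] by blast
  have exE: "(\<exists>y. E x y \<and> P y) \<longleftrightarrow> (\<exists>y\<in>V. E x y \<and> P y)" for x P
    using G(1) unfolding graph_def by metis
  show ?case
    unfolding cop_wins.simps inj[OF Suc.prems] exF[OF Suc.prems(1)] exE allF[OF Suc.prems(2)] allE
    using inj Suc.IH Suc.prems by (intro disj_cong refl bex_cong conj_cong ball_cong imp_cong) auto
qed

lemma capture_iso:
  assumes G: "graph V E" "graph W F" and f: "graph_iso V E W F"
  shows "cop_win V E \<longleftrightarrow> cop_win W F" "capture_time V E = capture_time W F" "card V = card W"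
proof -
  obtain f where f: "bij_betw f V W" "\<forall>x\<in>V. \<forall>y\<in>V. E x y \<longleftrightarrow> F (f x) (f y)"
    using f by (auto simp: graph_iso_def)
  have im: "W = f ` V" using f(1) by (simp add: bij_betw_def)
  have "(\<exists>c\<in>W. \<forall>r\<in>W. cop_wins F k c r) \<longleftrightarrow> (\<exists>c\<in>V. \<forall>r\<in>V. cop_wins E k c r)" for k
    unfolding im using cop_wins_iso[OF G f] by simp
  then show "cop_win V E \<longleftrightarrow> cop_win W F" "capture_time V E = capture_time W F"
    by (simp_all add: cop_win_def capture_time_def)
  show "card V = card W" using f(1) by (rule bij_betw_same_card)
qed

text \<open>Proper inclusion of neighbourhoods is unfolded to single vertices, which suits explicit
  graphs where the witnesses can be named.\<close>

lemma mem_core_iff: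
  "v \<in> core E S \<longleftrightarrow> v \<in> S \<and> (\<forall>w\<in>S. (\<exists>u\<in>S. E v u \<and> \<not> E w u) \<or> (\<forall>u\<in>S. E w u \<longrightarrow> E v u))"
proof -
  have "nbhd E S v \<subset> nbhd E S w \<longleftrightarrow>
      \<not> ((\<exists>u\<in>S. E v u \<and> \<not> E w u) \<or> (\<forall>u\<in>S. E w u \<longrightarrow> E v u))" for w
    unfolding nbhd_def by blast
  then show ?thesis unfolding core_def strict_corners_def by auto
qed

lemma dominated_Gk_mono:
  assumes G: "graph V E" and "dominated E (Gk V E i)" "i \<le> j"
  shows "dominated E (Gk V E j)"
  using assms(3,2)
proof (induction j rule: dec_induct)
  case (step n)
  have R: "refl_graph E (Gk V E n)" "refl_graph E (Gk V E (Suc n))" using refl_graph_Gk[OF G] by blast+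
  show ?case using dominated_clique[OF R(2)] clique_core_of_dominated[OF R(1) step.IH[OF step.prems]]
    by (simp only: Gk_Suc_core)
qed

text \<open>Domination persists at all later levels, so the first dominated level is recognized by
  comparing it with the one before. With two vertices or more, zero moves never suffice.\<close>

lemma capture_time_eq_iff:
  assumes G: "graph V E" and c: "card V \<ge> 2" and w: "cop_win V E"
  shows "capture_time V E = Suc k \<longleftrightarrow>
    dominated E (Gk V E k) \<and> (k = 0 \<or> \<not> dominated E (Gk V E (k - 1)))"
proof -
  define m where "m = (LEAST k. dominated E (Gk V E k))"
  have ex: "\<exists>k. dominated E (Gk V E k)" using w cop_win_iff[OF G] by simp
  have m: "dominated E (Gk V E m)" unfolding m_def by (rule LeastI_ex[OF ex])
  have nm: "\<not> dominated E (Gk V E j)" if "j < m" for j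
    using not_less_Least that unfolding m_def by blast
  have "capture_time V E = Suc m" by (rule capture_time_eq_Suc[OF G c m nm])
  moreover have "m = k" if "dominated E (Gk V E k)" "k = 0 \<or> \<not> dominated E (Gk V E (k - 1))"
  proof (rule antisym)
    show "m \<le> k" using nm[of k] that(1) by (meson not_less)
    show "k \<le> m" using dominated_Gk_mono[OF G m, of "k - 1"] that(2) by force
  qed
  ultimately show ?thesis using m nm[of "m - 1"] by (metis diff_less less_one neq0_conv nat.inject)
qed

section \<open>Levels and capture time of a path\<close>

lemma path_graph: "n \<ge> 1 \<Longrightarrow> graph (path_V n) (path_E n)"
  by (auto simp: graph_def path_V_def path_E_def)

text \<open>The neighbour of an end sees one vertex more once there are three vertices. An inner
  \<open>v\<close> is adjacent to \<open>v - 1\<close> and \<open>v + 1\<close>, and every other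
  vertex misses one of these.\<close>

lemma core_path:
  assumes "a + 3 \<le> b" "b \<le> n"
  shows "core (path_E n) {a..<b} = {Suc a..<b - 1}"
proof (intro set_eqI iffI)
  fix v assume v: "v \<in> core (path_E n) {a..<b}"
  have n: "v \<in> {a..<b}"
    "\<forall>w\<in>{a..<b}. (\<exists>u\<in>{a..<b}. path_E n v u \<and> \<not> path_E n w u) \<or> (\<forall>u\<in>{a..<b}. path_E n w u \<longrightarrow> path_E n v u)"
    using v unfolding mem_core_iff by auto
  have "v \<noteq> a"
  proof
    assume "v = a"
    moreover have "(\<exists>u\<in>{a..<b}. path_E n v u \<and> \<not> path_E n (a+1) u) \<or> (\<forall>u\<in>{a..<b}. path_E n (a+1) u \<longrightarrow> path_E n v u)"
      using n(2)[rule_format, of "a+1"] assms by auto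
    moreover have "path_E n (a+1) (a+2)" "\<not> path_E n a (a+2)" "a + 2 \<in> {a..<b}" using assms by (auto simp: path_E_def)
    ultimately show False using assms by (auto simp: path_E_def)
  qed
  moreover have "v \<noteq> b - 1"
  proof
    assume "v = b - 1"
    moreover have "(\<exists>u\<in>{a..<b}. path_E n v u \<and> \<not> path_E n (b-2) u) \<or> (\<forall>u\<in>{a..<b}. path_E n (b-2) u \<longrightarrow> path_E n v u)"
      using n(2)[rule_format, of "b-2"] assms by auto
    moreover have "path_E n (b-2) (b-3)" "\<not> path_E n (b-1) (b-3)" "b - 3 \<in> {a..<b}"
      using assms by (auto simp: path_E_def)
    ultimately show False using assms by (auto simp: path_E_def)
  qed
  ultimately show "v \<in> {Suc a..<b - 1}" using n(1) by auto
next
  fix v assume v: "v \<in> {Suc a..<b - 1}"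
  have "(\<exists>u\<in>{a..<b}. path_E n v u \<and> \<not> path_E n w u) \<or> (\<forall>u\<in>{a..<b}. path_E n w u \<longrightarrow> path_E n v u)"
    if "w \<in> {a..<b}" for w
  proof -
    consider "w = v" | "w < v" | "w > v" by linarith
    then show ?thesis
    proof cases
      case 2
      then show ?thesis using v assms by (intro disjI1 bexI[of _ "v+1"]) (auto simp: path_E_def)
    next
      case 3
      then show ?thesis using v assms by (intro disjI1 bexI[of _ "v-1"]) (auto simp: path_E_def)
    qed auto
  qed
  then show "v \<in> core (path_E n) {a..<b}" using v unfolding mem_core_iff by auto
qed

lemma Gk_path: "2 * j < n \<Longrightarrow> Gk (path_V n) (path_E n) j = {j..<n - j}"
proof (induction j)
  case 0 then show ?case by (simp add: path_V_def)
next
  case (Suc j)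
  then show ?case unfolding Gk_Suc_core using core_path[of j "n - j" n] by simp
qed

lemma dominated_path:
  assumes "a < b" "b \<le> n" shows "dominated (path_E n) {a..<b} \<longleftrightarrow> b \<le> a + 3"
proof
  assume "dominated (path_E n) {a..<b}"
  then obtain v where "v \<in> {a..<b}" "path_E n v a" "path_E n v (b - 1)"
    using assms by (auto simp: dominated_def)
  then show "b \<le> a + 3" by (auto simp: path_E_def)
next
  assume "b \<le> a + 3"
  then have "\<forall>u\<in>{a..<b}. path_E n ((a + b) div 2) u" "(a + b) div 2 \<in> {a..<b}"
    using assms by (auto simp: path_E_def)
  then show "dominated (path_E n) {a..<b}" by (auto simp: dominated_def)
qed

lemma path_capture:
  assumes "n \<ge> 1"
  shows "cop_win (path_V n) (path_E n)" "capture_time (path_V n) (path_E n) = n div 2"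
proof -
  note G = path_graph[OF assms]
  have c: "card (path_V n) = n" by (simp add: path_V_def)
  show w: "cop_win (path_V n) (path_E n)"
  proof (cases "n = 1")
    case True then show ?thesis using capture_time_singleton[OF G] c by simp
  next
    case False
    then have "dominated (path_E n) (Gk (path_V n) (path_E n) ((n - 2) div 2))"
      using assms by (subst Gk_path) (auto simp: dominated_path)
    then show ?thesis using cop_win_iff[OF G] by blast
  qed
  show "capture_time (path_V n) (path_E n) = n div 2"
  proof (cases "n = 1")
    case True then show ?thesis using capture_time_singleton[OF G] c by simp
  next
    case False
    \<comment> \<open>Level \<open>j\<close> of the path has \<open>n - 2 * j\<close> vertices, and
      \<open>(n - 2) div 2\<close> is the first level with at most three of them.\<close>
    then have "n div 2 = Suc ((n - 2) div 2)" using assms by linarith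
    moreover have "capture_time (path_V n) (path_E n) = Suc ((n - 2) div 2)"
      using False assms c w
      by (subst capture_time_eq_iff[OF G]) (auto simp: Gk_path dominated_path)
    ultimately show ?thesis by simp
  qed
qed

text \<open>A path with \<open>k\<close> edges is attached at the vertex \<open>d = 6\<close> of H_7.\<close>
definition tail_E :: "nat \<Rightarrow> nat \<Rightarrow> nat \<Rightarrow> bool" where
  "tail_E k i j \<longleftrightarrow> H7_E i j \<or> 6 \<le> i \<and> 6 \<le> j \<and> i < 7 + k \<and> j < 7 + k \<and> i \<le> j + 1 \<and> j \<le> i + 1"

section \<open>H_7 with a tail\<close>

lemma H7_E_bound: "H7_E i j \<Longrightarrow> i < 7 \<and> j < 7"
  by (auto simp: H7_E_def H7_V_def H7_edges_def)

lemma H7_E_sym: "H7_E i j \<Longrightarrow> H7_E j i"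
  by (auto simp: H7_E_def)

lemma tail_E_H7: "i < 7 \<Longrightarrow> j < 7 \<Longrightarrow> tail_E k i j \<longleftrightarrow> H7_E i j"
  by (auto simp: tail_E_def H7_E_def H7_V_def)

lemma tail_E_big: "i \<ge> 7 \<or> j \<ge> 7 \<Longrightarrow>
    tail_E k i j \<longleftrightarrow> 6 \<le> i \<and> 6 \<le> j \<and> i < 7 + k \<and> j < 7 + k \<and> i \<le> j + 1 \<and> j \<le> i + 1"
  using H7_E_bound[of i j] by (auto simp: tail_E_def)

lemma tail_graph: "graph {0..<7 + k} (tail_E k)"
  unfolding graph_def
proof (intro conjI ballI allI impI)
  fix x y :: nat
  show "tail_E k x x" if "x \<in> {0..<7 + k}"
    using that by (auto simp: tail_E_def H7_E_def H7_V_def)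
  assume "tail_E k x y"
  then show "tail_E k y x" "x \<in> {0..<7 + k}" "y \<in> {0..<7 + k}"
    using H7_E_bound[of x y] H7_E_sym[of x y] by (auto simp: tail_E_def)
qed auto

text \<open>Only \<open>d = 6\<close> can be a strict corner of H_7. The tail is attached exactly
  there, so it leaves the other six vertices undisturbed.\<close>

lemma H7_noncorner:
  assumes "v < 6" "w < 7" "w \<noteq> v"
  shows "\<exists>u<7. H7_E v u \<and> \<not> H7_E w u"
proof -
  have "\<forall>v\<in>{0,1,2,3,4,5}. \<forall>w\<in>{0,1,2,3,4,5,6}. w \<noteq> v \<longrightarrow>
      (\<exists>u\<in>{0,1,2,3,4,5,6}. H7_E v u \<and> \<not> H7_E w u)"
    by (simp add: H7_E_def H7_edges_def H7_V_def)
  then have "\<forall>v\<in>{0,1,2,3,4,5}. \<forall>w\<in>{0,1,2,3,4,5,6}. w \<noteq> v \<longrightarrow> (\<exists>u<7. H7_E v u \<and> \<not> H7_E w u)"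
    using H7_E_bound by metis
  moreover have "v \<in> {0,1,2,3,4,5}" "w \<in> {0,1,2,3,4,5,6}" using assms by auto
  ultimately show ?thesis using assms(3) by metis
qed

text \<open>Every vertex from \<open>6\<close> up to the last but one is kept by its neighbours on
  both sides, and the last is cornered by its predecessor. So the tail is consumed one vertex at a
  time, and \<open>6\<close> becomes a corner only when the tail is gone.\<close>

lemma core_tail:
  assumes "m < k" shows "core (tail_E k) {0..<8 + m} = {0..<7 + m}"
proof (intro set_eqI iffI)
  fix v assume v: "v \<in> core (tail_E k) {0..<8 + m}"
  have "v \<noteq> 7 + m"
  proof
    assume v7: "v = 7 + m"
    have "(\<exists>u\<in>{0..<8 + m}. tail_E k v u \<and> \<not> tail_E k (6 + m) u) \<or>
          (\<forall>u\<in>{0..<8 + m}. tail_E k (6 + m) u \<longrightarrow> tail_E k v u)"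
      using v unfolding mem_core_iff by auto
    moreover have "tail_E k (6 + m) u" if "tail_E k v u" "u < 8 + m" for u
      using that v7 by (auto simp: tail_E_big) (auto simp: tail_E_def)
    moreover have "\<exists>u<8 + m. tail_E k (6 + m) u \<and> \<not> tail_E k v u"
    proof (cases m)
      \<comment> \<open>\<open>2\<close> is \<open>b1\<close>, a neighbour of \<open>d = 6\<close>
        that the first tail vertex \<open>7\<close> misses.\<close>
      case 0
      then show ?thesis using v7
        by (intro exI[of _ 2]) (auto simp: tail_E_H7 tail_E_big H7_E_def H7_edges_def)
    next
      case (Suc i)
      then show ?thesis using v7 assms by (intro exI[of _ "6 + i"]) (auto simp: tail_E_big)
    qed
    ultimately show False by auto
  qed
  then show "v \<in> {0..<7 + m}" using v unfolding mem_core_iff by auto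
next
  fix v assume v: "v \<in> {0..<7 + m}"
  have *: "\<exists>u\<in>{0..<8 + m}. tail_E k v u \<and> \<not> tail_E k w u" if w: "w < 8 + m" "w \<noteq> v" for w
  proof -
    consider "v < 6" "w < 7" | "v < 6" "w \<ge> 7" | "v \<ge> 7" "w < v" | "v \<ge> 6" "w > v" | "v = 6" "w < 6"
      using w(2) by linarith
    then show ?thesis
    proof cases
      case 1
      then obtain u where u: "u < 7" "H7_E v u" "\<not> H7_E w u" using H7_noncorner w by blast
      then show ?thesis using 1 by (intro bexI[of _ u]) (auto simp: tail_E_H7)
    next
      case 2
      then show ?thesis
        by (intro bexI[of _ v]) (auto simp: tail_E_H7 tail_E_big H7_E_def H7_V_def)
    next
      case 3
      then show ?thesis using v assms by (intro bexI[of _ "v+1"]) (auto simp: tail_E_big)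
    next
      case 4
      show ?thesis
      proof (cases "v = 6")
        case True
        then show ?thesis using 4
          by (intro bexI[of _ 2]) (auto simp: tail_E_H7 tail_E_big H7_E_def H7_edges_def)
      next
        case False
        then show ?thesis using 4 v assms by (intro bexI[of _ "v - 1"]) (auto simp: tail_E_big)
      qed
    next
      case 5
      then show ?thesis using v assms by (intro bexI[of _ 7]) (auto simp: tail_E_big)
    qed
  qed
  show "v \<in> core (tail_E k) {0..<8 + m}"
    unfolding mem_core_iff
  proof (intro conjI ballI)
    fix w assume "w \<in> {0..<8 + m}"
    then show "(\<exists>u\<in>{0..<8 + m}. tail_E k v u \<and> \<not> tail_E k w u) \<or>
        (\<forall>u\<in>{0..<8 + m}. tail_E k w u \<longrightarrow> tail_E k v u)"
      using *[of w] by (cases "w = v") auto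
  qed (use v in auto)
qed

lemma Gk_tail: "j \<le> k \<Longrightarrow> Gk {0..<7 + k} (tail_E k) j = {0..<7 + k - j}"
proof (induction j)
  case (Suc j)
  then have "{0..<7 + k - j} = {0..<8 + (k - Suc j)}" "{0..<7 + k - Suc j} = {0..<7 + (k - Suc j)}"
    by auto
  then show ?case using Suc core_tail[of "k - Suc j" k] unfolding Gk_Suc_core by simp
qed simp

lemma core_cong:
  assumes "\<And>x y. x \<in> S \<Longrightarrow> y \<in> S \<Longrightarrow> E x y \<longleftrightarrow> F x y"
  shows "core E S = core F S"
proof -
  have "nbhd E S v = nbhd F S v" if "v \<in> S" for v
    using assms that by (auto simp: nbhd_def)
  then show ?thesis unfolding core_def strict_corners_def by auto
qed

lemma core_eqI:
  assumes S: "S = C \<union> D"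
    and C: "\<forall>v\<in>C. \<forall>w\<in>S. w \<noteq> v \<longrightarrow> (\<exists>u\<in>S. E v u \<and> \<not> E w u)"
    and D: "\<forall>v\<in>D. \<exists>w\<in>S. (\<forall>u\<in>S. E v u \<longrightarrow> E w u) \<and> (\<exists>u\<in>S. E w u \<and> \<not> E v u)"
  shows "core E S = C"
proof (intro set_eqI iffI)
  fix v assume v: "v \<in> core E S"
  then have "v \<notin> D" using D unfolding mem_core_iff by blast
  then show "v \<in> C" using v S by (auto simp: core_def)
next
  fix v assume v: "v \<in> C"
  have "(\<exists>u\<in>S. E v u \<and> \<not> E w u) \<or> (\<forall>u\<in>S. E w u \<longrightarrow> E v u)" if "w \<in> S" for w
    using C v that by (cases "w = v") auto
  then show "v \<in> core E S" unfolding mem_core_iff using v S by blast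
qed

lemma core_H7: "core H7_E {0..<7} = {0..<6}" "core H7_E {0..<6} = {0..<4}"
proof -
  have s: "{0..<7} = {0,1,2,3,4,5,6::nat}" "{0..<6} = {0,1,2,3,4,5::nat}" "{0..<4} = {0,1,2,3::nat}" by auto
  show "core H7_E {0..<7} = {0..<6}"
    unfolding s by (rule core_eqI[where D = "{6}"], force,
      (simp add: H7_E_def H7_edges_def H7_V_def)+)
  show "core H7_E {0..<6} = {0..<4}"
    unfolding s by (rule core_eqI[where D = "{4,5}"], force,
      (simp add: H7_E_def H7_edges_def H7_V_def)+)
qed

text \<open>The first dominated level is \<open>{0..<4}\<close>, that is \<open>a1\<close>,
  \<open>a2\<close>, \<open>b1\<close>, \<open>b2\<close>. While \<open>c1\<close> and
  \<open>c2\<close> are present, each of \<open>a1\<close>, \<open>a2\<close> misses one of them,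
  and \<open>b1\<close>, \<open>b2\<close> as well as \<open>c1\<close>, \<open>c2\<close> miss each
  other.\<close>

lemma tail_capture:
  "cop_win {0..<7 + k} (tail_E k)" "capture_time {0..<7 + k} (tail_E k) = k + 3"
proof -
  note G = tail_graph[of k]
  let ?S = "Gk {0..<7 + k} (tail_E k)"
  have S0: "?S k = {0..<7}" using Gk_tail[of k k] by simp
  have S1: "?S (Suc k) = {0..<6}"
    unfolding Gk_Suc_core S0 using core_cong[of "{0..<7}" "tail_E k" H7_E] core_H7
    by (simp add: tail_E_H7)
  have S2: "?S (k + 2) = {0..<4}"
    unfolding add_2_eq_Suc' Gk_Suc_core[of _ _ "Suc k"] S1
    using core_cong[of "{0..<6}" "tail_E k" H7_E] core_H7 by (simp add: tail_E_H7)
  have s: "{0..<6} = {0,1,2,3,4,5::nat}" "{0..<4} = {0,1,2,3::nat}" by auto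
  have d: "dominated (tail_E k) (?S (k + 2))"
    unfolding S2 s dominated_def by (simp add: tail_E_H7 H7_E_def H7_edges_def H7_V_def)
  moreover have "\<not> dominated (tail_E k) (?S (Suc k))"
    unfolding S1 s dominated_def by (simp add: tail_E_H7 H7_E_def H7_edges_def H7_V_def)
  moreover show w: "cop_win {0..<7 + k} (tail_E k)" using d cop_win_iff[OF G] by blast
  ultimately have "capture_time {0..<7 + k} (tail_E k) = Suc (k + 2)"
    by (subst capture_time_eq_iff[OF G]) auto
  then show "capture_time {0..<7 + k} (tail_E k) = k + 3" by simp
qed

lemma H7_capture: "graph H7_V H7_E" "capture_time H7_V H7_E = 3"
proof -
  have "tail_E 0 = H7_E"
  proof (intro ext)
    fix i j
    show "tail_E 0 i j = H7_E i j"
      using H7_E_bound[of i j] tail_E_H7[of i j 0] tail_E_big[of i j 0] by (metis add_0_right not_le)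
  qed
  then show "graph H7_V H7_E" "capture_time H7_V H7_E = 3"
    using tail_graph[of 0] tail_capture(2)[of 0] by (simp_all add: H7_V_def)
qed

section \<open>Sizes of the rank classes\<close>

text \<open>One less than the corner rank, because levels are counted from 0. Below the top,
  \<open>layer V E j\<close> is the size of the class of rank \<open>j + 1\<close>.\<close>

definition top_index :: "'a set \<Rightarrow> ('a \<Rightarrow> 'a \<Rightarrow> bool) \<Rightarrow> nat" where
  "top_index V E = (LEAST k. is_clique E (Gk V E k))"

definition layer :: "'a set \<Rightarrow> ('a \<Rightarrow> 'a \<Rightarrow> bool) \<Rightarrow> nat \<Rightarrow> nat" where
  "layer V E j = card (Gk V E j - Gk V E (Suc j))"

lemma corner_rank_top: "corner_rank V E = Suc (top_index V E)"
  by (simp add: corner_rank_def top_index_def)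

lemma rcv_eq: "rcv V E = card (Gk V E (top_index V E)) # map (layer V E) (rev [0..<top_index V E])"
proof -
  let ?m = "top_index V E"
  have "rev [1..<Suc (Suc ?m)] = Suc ?m # map Suc (rev [0..<?m])"
    by (simp add: map_Suc_upt flip: rev_map)
  moreover have "map (\<lambda>k. card (rank_class V E k)) (map Suc (rev [0..<?m])) = map (layer V E) (rev [0..<?m])"
    by (auto simp: rank_class_def corner_rank_top layer_def)
  ultimately show ?thesis
    by (simp add: rcv_def corner_rank_top) (simp add: rank_class_def corner_rank_top)
qed

context
  fixes V :: "'a set" and E
  assumes G: "graph V E" and W: "cop_win V E"
begin

lemma refl_graph_layers: "refl_graph E (Gk V E j)"
  by (rule refl_graph_Gk[OF G])

lemma core_layer: "core E (Gk V E j) = Gk V E (Suc j)"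
  by (simp only: Gk_Suc_core)

lemma ex_clique: "\<exists>k. is_clique E (Gk V E k)"
  using cop_win_iff[OF G] W clique_core_of_dominated[OF refl_graph_layers] unfolding core_layer by blast

lemma top_clique: "is_clique E (Gk V E (top_index V E))"
  unfolding top_index_def by (rule LeastI_ex[OF ex_clique])

lemma not_clique_below_top: "j < top_index V E \<Longrightarrow> \<not> is_clique E (Gk V E j)"
  unfolding top_index_def by (rule not_less_Least)

text \<open>If a level had no strict corner, all later levels would equal it, and the clique at the
  top would never be reached.\<close>

lemma layer_pos:
  assumes "j < top_index V E" shows "layer V E j \<ge> 1"
proof (rule ccontr)
  assume "\<not> ?thesis"
  then have "Gk V E j - Gk V E (Suc j) = {}"
    using refl_graphD(1)[OF refl_graph_layers[of j]] by (simp add: layer_def Suc_le_eq card_gt_0_iff del: Gk.simps)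
  then have eq: "Gk V E (Suc j) = Gk V E j" by auto
  have "Gk V E (j + i) = Gk V E j" for i
    using eq by (induction i) auto
  from this[of "top_index V E - j"] show False
    using top_clique not_clique_below_top[OF assms] assms by simp
qed

lemma card_layers: "card (Gk V E j) = layer V E j + card (Gk V E (Suc j))"
proof -
  have "Gk V E (Suc j) \<subseteq> Gk V E j" by auto
  then show ?thesis unfolding layer_def
    by (metis add.commute card_Diff_subset card_mono finite_subset le_add_diff_inverse
        refl_graphD(1)[OF refl_graph_layers])
qed

lemma card_ge_layers:
  "i + l \<le> top_index V E \<Longrightarrow> card (Gk V E i) \<ge> card (Gk V E (i + l)) + l"
proof (induction l)
  case (Suc l)
  then show ?case using card_layers[of "i + l"] layer_pos[of "i + l"] by simp
qed simp

text \<open>Every layer has at least one vertex, so a total that allows just one for each leaves no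
  room for a larger layer.\<close>

lemma layers_eq_1:
  "l \<le> top_index V E \<Longrightarrow> card V \<le> card (Gk V E l) + l \<Longrightarrow> j < l \<Longrightarrow> layer V E j = 1"
proof (induction l)
  case (Suc l)
  have a: "card (Gk V E l) = layer V E l + card (Gk V E (Suc l))" by (rule card_layers)
  have b: "layer V E l \<ge> 1" using layer_pos Suc.prems by simp
  have "card V \<ge> card (Gk V E l) + l" using card_ge_layers[of 0 l] Suc.prems by simp
  then have "layer V E l = 1" "card V \<le> card (Gk V E l) + l" using a b Suc.prems by auto
  then show ?case using Suc by (cases "j = l") auto
qed simp

text \<open>A vertex that dominates the level just below the top is no strict corner of it, so it
  has top rank automatically, as \<open>type1\<close> demands.\<close>

lemma type1_iff: "type1 V E \<longleftrightarrow> top_index V E \<ge> 1 \<and> dominated E (Gk V E (top_index V E - 1))"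
proof (cases "top_index V E")
  case 0 then show ?thesis by (simp add: type1_def corner_rank_top)
next
  case (Suc m)
  have "(\<exists>v\<in>Gk V E (Suc m). \<forall>u\<in>Gk V E m. E v u) \<longleftrightarrow> dominated E (Gk V E m)"
    using dominating_in_core[of _ "Gk V E m" E] unfolding core_layer dominated_def by auto
  then show ?thesis using Suc by (simp add: type1_def corner_rank_top rank_class_def del: Gk.simps)
qed

lemma capture_clique:
  assumes "card V \<ge> 2" "top_index V E = 0" shows "capture_time V E = 1"
proof -
  have "dominated E (Gk V E 0)"
    using dominated_clique[OF refl_graph_layers] top_clique assms(2) by metis
  then show ?thesis using capture_time_eq_iff[OF G assms(1) W, of 0] by simp
qed

lemma card_ge_2_of_top: "top_index V E \<ge> 1 \<Longrightarrow> card V \<ge> 2"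
proof -
  assume "top_index V E \<ge> 1"
  moreover have "card (Gk V E j) \<noteq> 0" for j
    using refl_graph_layers[of j] by (auto simp: refl_graph_def)
  ultimately show ?thesis using card_ge_layers[of 0 1] by (metis Suc_1 Suc_leI add_0 add_leE gr0I Gk.simps(1) le_trans not_less_eq_eq plus_1_eq_Suc One_nat_def add.commute)
qed

lemma capture_type1:
  assumes "top_index V E \<ge> 1" "dominated E (Gk V E (top_index V E - 1))"
  shows "capture_time V E = top_index V E"
proof -
  obtain m where m: "top_index V E = Suc m" using assms(1) by (cases "top_index V E") auto
  \<comment> \<open>A dominating vertex of level \<open>m - 1\<close> would make level
    \<open>m\<close> a clique, but the first clique is level \<open>Suc m\<close>.\<close>
  have "\<not> dominated E (Gk V E (m - 1))" if "m \<noteq> 0"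
  proof
    assume "dominated E (Gk V E (m - 1))"
    then have "is_clique E (Gk V E m)"
      using clique_core_of_dominated[OF refl_graph_layers, of "m - 1"] that unfolding core_layer by simp
    then show False using not_clique_below_top[of m] m by simp
  qed
  then show ?thesis
    using capture_time_eq_iff[OF G card_ge_2_of_top[OF assms(1)] W, of m] assms(2) m by auto
qed

lemma capture_type0:
  assumes "top_index V E \<ge> 1" "\<not> dominated E (Gk V E (top_index V E - 1))"
  shows "capture_time V E = Suc (top_index V E)"
  using capture_time_eq_iff[OF G card_ge_2_of_top[OF assms(1)] W, of "top_index V E"] assms
    dominated_clique[OF refl_graph_layers top_clique] by auto

lemma single_layer:
  assumes "layer V E j = 1" obtains s where "Gk V E j - Gk V E (Suc j) = {s}"
  using assms card_1_singletonE unfolding layer_def by blast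

text \<open>These are the inputs for counting, with the classes read from the top clique at level
  \<open>Suc m\<close> downwards. By the last clause, a fourth class of size 1 requires at least six
  vertices in the first two classes together.\<close>

lemma type0_layers:
  assumes t: "top_index V E = Suc m" and d: "\<not> dominated E (Gk V E m)"
  shows "card (Gk V E (Suc m)) \<ge> 2" "layer V E m \<ge> 2"
    "m = Suc j \<Longrightarrow> layer V E j \<ge> 2"
    "m = Suc (Suc i) \<Longrightarrow> layer V E i = 1 \<Longrightarrow>
      \<not> (layer V E m = 2 \<or> layer V E m = 3 \<and> card (Gk V E (Suc m)) = 2)"
proof -
  note R = refl_graph_layers
  have cl: "is_clique E (Gk V E (Suc m))" using top_clique t by simp
  show "card (Gk V E (Suc m)) \<ge> 2" "layer V E m \<ge> 2"
    using clique_core_card[OF R, of m] d cl unfolding core_layer layer_def by auto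
  show "layer V E j \<ge> 2" if "m = Suc j"
  proof -
    have "layer V E j \<noteq> 1"
    proof
      assume "layer V E j = 1"
      then obtain s where "Gk V E j - Gk V E (Suc j) = {s}" by (rule single_layer)
      then show False
        using dominated_core_of_single_corner[OF R, of j s] d cl that unfolding core_layer by simp
    qed
    moreover have "layer V E j \<ge> 1" using layer_pos[of j] t that by simp
    ultimately show ?thesis by linarith
  qed
  show "\<not> (layer V E m = 2 \<or> layer V E m = 3 \<and> card (Gk V E (Suc m)) = 2)"
    if m: "m = Suc (Suc i)" and l: "layer V E i = 1"
  proof
    assume a: "layer V E m = 2 \<or> layer V E m = 3 \<and> card (Gk V E (Suc m)) = 2"
    obtain s where s: "Gk V E i - Gk V E (Suc i) = {s}" by (rule single_layer[OF l])
    obtain u where u: "u \<in> Gk V E m" "\<forall>z\<in>Gk V E (Suc i) - Gk V E m. E u z"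
      using ex_adjacent_to_previous_class[OF R core_layer[symmetric] core_layer[symmetric] s] m by auto
    show False
      using no_adjacent_small_clique_top[OF R[of "Suc i"] core_layer[of "Suc i", symmetric]
          core_layer[of "Suc (Suc i)", symmetric], of u] cl d u a
      unfolding m layer_def by auto
  qed
qed

text \<open>Level \<open>j\<close> is undominated, or level \<open>m\<close> would be a clique; so
  the third class falls under \<open>card_ge_2_of_undominated\<close>. By the last clause, a fourth
  class of size 1 requires two vertices at the top or four in the second class.\<close>

lemma type1_layers:
  assumes t: "top_index V E = Suc m" and d: "dominated E (Gk V E m)"
  shows "card (Gk V E (Suc m)) \<ge> 1" "layer V E m \<ge> 2"
    "m = Suc j \<Longrightarrow> layer V E j \<ge> 2 \<and> \<not> dominated E (Gk V E j)"
    "m = Suc (Suc i) \<Longrightarrow> card (Gk V E (Suc m)) = 1 \<Longrightarrow> layer V E m \<le> 3 \<Longrightarrow> layer V E i \<ge> 2"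
proof -
  note R = refl_graph_layers
  have nc: "\<not> is_clique E (Gk V E m)" using not_clique_below_top[of m] t by simp
  show "card (Gk V E (Suc m)) \<ge> 1"
    using R[of "Suc m"] by (simp add: refl_graph_def card_gt_0_iff Suc_le_eq del: Gk.simps)
  show "layer V E m \<ge> 2"
    using removed_card_ge_2_of_dominated[OF R d nc] unfolding core_layer layer_def .
  show j: "layer V E j \<ge> 2 \<and> \<not> dominated E (Gk V E j)" if "m = Suc j" for j
  proof -
    have "\<not> dominated E (Gk V E j)"
      using clique_core_of_dominated[OF R, of j] nc that unfolding core_layer by blast
    then show ?thesis using card_ge_2_of_undominated[OF R, of j] d that unfolding core_layer layer_def by simp
  qed
  show "layer V E i \<ge> 2" if m: "m = Suc (Suc i)" and c: "card (Gk V E (Suc m)) = 1" "layer V E m \<le> 3"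
  proof -
    have "layer V E i \<noteq> 1"
    proof
      assume "layer V E i = 1"
      then obtain s where s: "Gk V E i - Gk V E (Suc i) = {s}" by (rule single_layer)
      obtain u where u: "u \<in> Gk V E m" "\<forall>z\<in>Gk V E (Suc i) - Gk V E m. E u z"
        using ex_adjacent_to_previous_class[OF R core_layer[symmetric] core_layer[symmetric] s] m by auto
      obtain v where v: "Gk V E (Suc m) = {v}" using c(1) card_1_singletonE by blast
      show False
        using no_adjacent_small_single_top[OF R[of "Suc i"] core_layer[of "Suc i", symmetric], of v u]
          d j[of "Suc i"] m v c(2) u core_layer[of m] unfolding layer_def by auto
    qed
    moreover have "layer V E i \<ge> 1" using layer_pos[of i] t m by simp
    ultimately show ?thesis by linarith
  qed
qed

section \<open>Fewest vertices for a given type and corner rank\<close>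

lemma layer_path_extend:
  assumes "path_on E (Gk V E (Suc j)) n f" "n \<ge> 3"
  shows "layer V E j \<ge> 2" "layer V E j = 2 \<Longrightarrow> \<exists>g. path_on E (Gk V E j) (n + 2) g"
  using path_extend[OF refl_graph_layers[of j], of n f] assms unfolding core_layer layer_def by auto

lemma type0_path4:
  assumes "top_index V E = Suc m" "\<not> dominated E (Gk V E m)" "card (Gk V E (Suc m)) = 2" "layer V E m = 2"
  shows "\<exists>f. path_on E (Gk V E m) 4 f"
  using path4[OF refl_graph_layers[of m]] assms top_clique unfolding core_layer layer_def by simp

lemma type1_path3:
  assumes "top_index V E = Suc m" "dominated E (Gk V E m)" "card (Gk V E (Suc m)) = 1" "layer V E m = 2"
  shows "\<exists>f. path_on E (Gk V E m) 3 f"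
  using path3[OF refl_graph_layers[of m]] assms not_clique_below_top[of m] unfolding core_layer layer_def by simp

text \<open>The minimal sizes 2, 2, 2, 2 build a path on 8 vertices, while a fourth class of size 1
  leads to at least 9. A fifth class takes both cases to at least 10, since a path requires two new
  leaves. Hence for \<open>m \<ge> 3\<close> the capture time \<open>m + 2\<close> is at most
  \<open>card V - 5\<close>.\<close>

lemma type0_card:
  assumes t: "top_index V E = Suc m" and d: "\<not> dominated E (Gk V E m)"
  shows "m = 0 \<Longrightarrow> card V \<ge> 4 \<and> (card V = 4 \<longrightarrow> (\<exists>f. path_on E V 4 f))"
    "m = 1 \<Longrightarrow> card V \<ge> 6 \<and> (card V = 6 \<longrightarrow> (\<exists>f. path_on E V 6 f))"
    "m = 2 \<Longrightarrow> card V \<ge> 8 \<and> (card V = 8 \<longrightarrow> (\<exists>f. path_on E V 8 f))"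
    "m \<ge> 3 \<Longrightarrow> card V \<ge> m + 7"
proof -
  note L = type0_layers[OF t d]
  have c0: "card (Gk V E m) = layer V E m + card (Gk V E (Suc m))" by (rule card_layers)
  have P4: "\<exists>f. path_on E (Gk V E m) 4 f" if "card (Gk V E m) = 4"
  proof -
    have "card (Gk V E (Suc m)) = 2" "layer V E m = 2" using L(1,2) c0 that by linarith+
    then show ?thesis by (rule type0_path4[OF t d])
  qed
  show "card V \<ge> 4 \<and> (card V = 4 \<longrightarrow> (\<exists>f. path_on E V 4 f))" if "m = 0"
    using L(1,2) c0 P4 that by auto
  have B: "card (Gk V E j) \<ge> 6 \<and> (card (Gk V E j) = 6 \<longrightarrow> (\<exists>f. path_on E (Gk V E j) 6 f))"
    if m: "m = Suc j" for j
  proof -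
    have c: "card (Gk V E j) = layer V E j + card (Gk V E m)" using card_layers[of j] m by simp
    have "\<exists>f. path_on E (Gk V E j) 6 f" if "card (Gk V E j) = 6"
    proof -
      have 4: "card (Gk V E m) = 4" "layer V E j = 2" using that c c0 L(1,2) L(3)[OF m] by linarith+
      then obtain f where "path_on E (Gk V E (Suc j)) 4 f" using P4 m by auto
      then show ?thesis using layer_path_extend(2)[of j 4 f] 4 by auto
    qed
    moreover have "card (Gk V E j) \<ge> 6" using c c0 L(1,2) L(3)[OF m] by linarith
    ultimately show ?thesis by blast
  qed
  show "card V \<ge> 6 \<and> (card V = 6 \<longrightarrow> (\<exists>f. path_on E V 6 f))" if "m = 1"
    using B[of 0] that by simp
  have C: "card (Gk V E i) \<ge> 8 \<and> (card (Gk V E i) = 8 \<longrightarrow> (\<exists>f. path_on E (Gk V E i) 8 f))"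
    if m: "m = Suc (Suc i)" for i
  proof -
    have c: "card (Gk V E i) = layer V E i + card (Gk V E (Suc i))" using card_layers[of i] .
    have c1: "card (Gk V E (Suc i)) = layer V E (Suc i) + card (Gk V E m)" using card_layers[of "Suc i"] m by simp
    have p: "layer V E i \<ge> 1" using layer_pos[of i] t m by simp
    have b: "card (Gk V E i) \<ge> 9" if "layer V E i = 1"
      using c c0 c1 L(1,2) L(3)[OF m] L(4)[OF m that] that by linarith
    have 8: "card (Gk V E i) \<ge> 8"
      using b c c0 c1 L(1,2) L(3)[OF m] p by linarith
    moreover have "\<exists>f. path_on E (Gk V E i) 8 f" if "card (Gk V E i) = 8"
    proof -
      have 6: "card (Gk V E (Suc i)) = 6" "layer V E i = 2"
        using that b c c0 c1 L(1,2) L(3)[OF m] p by linarith+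
      then obtain f where "path_on E (Gk V E (Suc i)) 6 f" using B[OF m] by auto
      then show ?thesis using layer_path_extend(2)[of i 6 f] 6 by auto
    qed
    ultimately show ?thesis by blast
  qed
  show "card V \<ge> 8 \<and> (card V = 8 \<longrightarrow> (\<exists>f. path_on E V 8 f))" if "m = 2"
    using C[of 0] that by simp
  show "card V \<ge> m + 7" if m3: "m \<ge> 3"
  proof -
    have "m = Suc (Suc (Suc (m - 3)))" using m3 by simp
    then obtain i where m: "m = Suc (Suc (Suc i))" by blast
    have c: "card (Gk V E i) = layer V E i + card (Gk V E (Suc i))" using card_layers[of i] .
    have p: "layer V E i \<ge> 1" using layer_pos[of i] t m by simp
    have "layer V E i \<ge> 2" if "card (Gk V E (Suc i)) = 8"
      using C[of "Suc i"] m that layer_path_extend(1)[of i 8] by auto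
    then have "card (Gk V E i) \<ge> 10" using C[of "Suc i"] m c p by (cases "card (Gk V E (Suc i)) = 8") auto
    then show ?thesis using card_ge_layers[of 0 i] t m by simp
  qed
qed

text \<open>The minimal sizes 1, 2, 2 build a path on 5 vertices, which a fourth class of size 2
  extends to 7. The other way to total 7 is 2, 2, 2, 1, and only this one can be continued by
  classes of size 1, since a path requires two new leaves.\<close>

lemma type1_card:
  assumes t: "top_index V E = Suc m" and d: "dominated E (Gk V E m)"
  shows "m = 0 \<Longrightarrow> card V \<ge> 3 \<and> (card V = 3 \<longrightarrow> (\<exists>f. path_on E V 3 f))"
    "m = 1 \<Longrightarrow> card V \<ge> 5 \<and> (card V = 5 \<longrightarrow> (\<exists>f. path_on E V 5 f))"
    "m \<ge> 2 \<Longrightarrow> card V \<ge> m + 5"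
    "m \<ge> 2 \<Longrightarrow> card V = m + 5 \<Longrightarrow> (m = 2 \<and> (\<exists>f. path_on E V 7 f)) \<or>
       card (Gk V E (Suc m)) = 2 \<and> layer V E m = 2 \<and> layer V E (m - 1) = 2 \<and> (\<forall>j<m - 1. layer V E j = 1)"
proof -
  note L = type1_layers[OF t d]
  have c0: "card (Gk V E m) = layer V E m + card (Gk V E (Suc m))" by (rule card_layers)
  have P3: "\<exists>f. path_on E (Gk V E m) 3 f" if "card (Gk V E m) = 3"
  proof -
    have "card (Gk V E (Suc m)) = 1" "layer V E m = 2" using L(1,2) c0 that by linarith+
    then show ?thesis by (rule type1_path3[OF t d])
  qed
  show "card V \<ge> 3 \<and> (card V = 3 \<longrightarrow> (\<exists>f. path_on E V 3 f))" if "m = 0"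
    using L(1,2) c0 P3 that by auto
  have B: "card (Gk V E j) \<ge> 5 \<and> (card (Gk V E j) = 5 \<longrightarrow> (\<exists>f. path_on E (Gk V E j) 5 f))"
    if m: "m = Suc j" for j
  proof -
    have c: "card (Gk V E j) = layer V E j + card (Gk V E m)" using card_layers[of j] m by simp
    have l2: "layer V E j \<ge> 2" using L(3)[OF m] by simp
    have "\<exists>f. path_on E (Gk V E j) 5 f" if "card (Gk V E j) = 5"
    proof -
      have 4: "card (Gk V E m) = 3" "layer V E j = 2" using that c c0 L(1,2) l2 by linarith+
      then obtain f where "path_on E (Gk V E (Suc j)) 3 f" using P3 m by auto
      then show ?thesis using layer_path_extend(2)[of j 3 f] 4 by auto
    qed
    moreover have "card (Gk V E j) \<ge> 5" using c c0 L(1,2) l2 by linarith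
    ultimately show ?thesis by blast
  qed
  show "card V \<ge> 5 \<and> (card V = 5 \<longrightarrow> (\<exists>f. path_on E V 5 f))" if "m = 1"
    using B[of 0] that by simp
  have C: "card (Gk V E i) \<ge> 7"
    "card (Gk V E i) = 7 \<Longrightarrow> (\<exists>f. path_on E (Gk V E i) 7 f) \<or>
      card (Gk V E (Suc m)) = 2 \<and> layer V E m = 2 \<and> layer V E (Suc i) = 2 \<and> layer V E i = 1"
    if m: "m = Suc (Suc i)" for i
  proof -
    have c: "card (Gk V E i) = layer V E i + card (Gk V E (Suc i))" using card_layers[of i] .
    have c1: "card (Gk V E (Suc i)) = layer V E (Suc i) + card (Gk V E m)" using card_layers[of "Suc i"] m by simp
    have p: "layer V E i \<ge> 1" using layer_pos[of i] t m by simp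
    have l2: "layer V E (Suc i) \<ge> 2" using L(3)[OF m] by simp
    have b: "layer V E i \<ge> 2 \<or> card (Gk V E (Suc m)) \<ge> 2 \<or> layer V E m \<ge> 4"
      using L(1) L(4)[OF m] by linarith
    then show "card (Gk V E i) \<ge> 7" using c c0 c1 L(1,2) l2 p by linarith
    assume 7: "card (Gk V E i) = 7"
    show "(\<exists>f. path_on E (Gk V E i) 7 f) \<or>
      card (Gk V E (Suc m)) = 2 \<and> layer V E m = 2 \<and> layer V E (Suc i) = 2 \<and> layer V E i = 1"
    proof (cases "card (Gk V E (Suc i)) = 5")
      case True
      then obtain f where "path_on E (Gk V E (Suc i)) 5 f" using B[OF m] by auto
      then show ?thesis using layer_path_extend(2)[of i 5 f] 7 c True by auto
    next
      case False
      then show ?thesis using 7 b c c0 c1 L(1,2) l2 p by linarith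
    qed
  qed
  show ge: "card V \<ge> m + 5" if "m \<ge> 2"
  proof -
    have "m = Suc (Suc (m - 2))" using that by simp
    then obtain i where m: "m = Suc (Suc i)" by blast
    show ?thesis using C(1)[OF m] card_ge_layers[of 0 i] t m by simp
  qed
  show "(m = 2 \<and> (\<exists>f. path_on E V 7 f)) \<or>
       card (Gk V E (Suc m)) = 2 \<and> layer V E m = 2 \<and> layer V E (m - 1) = 2 \<and> (\<forall>j<m - 1. layer V E j = 1)"
    if "m \<ge> 2" and V: "card V = m + 5"
  proof -
    have "m = Suc (Suc (m - 2))" using \<open>m \<ge> 2\<close> by simp
    then obtain i where m: "m = Suc (Suc i)" by blast
    have 7: "card (Gk V E i) = 7" using C(1)[OF m] card_ge_layers[of 0 i] t m V by simp
    have l1: "layer V E j = 1" if "j < i" for j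
      using layers_eq_1[of i j] that 7 V m t by simp
    from C(2)[OF m 7] show ?thesis
    proof
      assume p: "\<exists>f. path_on E (Gk V E i) 7 f"
      have "i = 0"
      proof (rule ccontr)
        assume "i \<noteq> 0"
        then obtain i' where i: "i = Suc i'" by (cases i) auto
        then show False using p layer_path_extend(1)[of i' 7] l1[of i'] by auto
      qed
      then show ?thesis using p m by simp
    next
      assume "card (Gk V E (Suc m)) = 2 \<and> layer V E m = 2 \<and> layer V E (Suc i) = 2 \<and> layer V E i = 1"
      then show ?thesis using l1 m by (auto simp: less_Suc_eq)
    qed
  qed
qed

end

section \<open>Extremal graphs\<close>

text \<open>The larger of \<open>n div 2\<close>, attained by paths, and \<open>n - 4\<close>,
  attained by H_7 with a tail; the two agree for 7 and 8.\<close>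

definition max_capture :: "nat \<Rightarrow> nat" where
  "max_capture n = (if n < 8 then n div 2 else n - 4)"

lemma map_eq_replicate_iff: "map f xs = replicate (length xs) c \<longleftrightarrow> (\<forall>x\<in>set xs. f x = c)"
  by (induction xs) auto

context
  fixes V :: "'a set" and E
  assumes G: "graph V E" and W: "cop_win V E"
begin

lemma in_H7plus_k_iff:
  "in_H7plus_k k V E \<longleftrightarrow> top_index V E = k + 3 \<and> card (Gk V E (k + 3)) = 2 \<and>
     layer V E (k + 2) = 2 \<and> layer V E (k + 1) = 2 \<and> (\<forall>j<k + 1. layer V E j = 1)"
proof -
  have l: "length (rcv V E) = Suc (top_index V E)" by (simp add: rcv_eq)
  have u: "rev [0..<k + 3] = (k + 2) # (k + 1) # rev [0..<Suc k]"
    by (simp add: numeral_eq_Suc)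
  \<comment> \<open>The length of the vector fixes the corner rank, after which the two lists can be
    compared entry by entry.\<close>
  have "rcv V E = [2, 2, 2] @ replicate (Suc k) 1 \<longleftrightarrow>
      top_index V E = k + 3 \<and> rcv V E = [2, 2, 2] @ replicate (Suc k) 1"
    using l by (auto dest: arg_cong[of _ _ length])
  also have "\<dots> \<longleftrightarrow> top_index V E = k + 3 \<and> card (Gk V E (k + 3)) = 2 \<and>
     layer V E (k + 2) = 2 \<and> layer V E (k + 1) = 2 \<and>
     map (layer V E) (rev [0..<Suc k]) = replicate (length (rev [0..<Suc k])) 1"
    unfolding rcv_eq by (intro conj_cong refl) (simp only: u, simp)
  finally show ?thesis
    unfolding in_H7plus_k_def realizes_def map_eq_replicate_iff using G W by (auto simp: less_Suc_eq)
qed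

lemma card_eq_layers_1: "(\<forall>j<l. layer V E j = 1) \<Longrightarrow> card V = card (Gk V E l) + l"
  by (induction l) (use card_layers[OF G W] in auto)

text \<open>The vector alone determines the type: a fourth class of size 1 together with a second
  class of size 2 excludes type 0.\<close>

lemma H7plus_capture:
  assumes "in_H7plus_k k V E" shows "capture_time V E = k + 3" "card V = k + 7"
proof -
  note H = assms[unfolded in_H7plus_k_iff]
  have t: "top_index V E = Suc (k + 2)" using H by simp
  have "dominated E (Gk V E (k + 2))"
  proof (rule ccontr)
    assume "\<not> ?thesis"
    from type0_layers(4)[OF G W t this, of k] H show False by simp
  qed
  then show "capture_time V E = k + 3" using capture_type1[OF G W] t by simp
  have "card V = card (Gk V E (k + 1)) + (k + 1)" using card_eq_layers_1[of "k + 1"] H by simp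
  also have "card (Gk V E (k + 1)) = 6"
    using card_layers[OF G W, of "k + 1"] card_layers[OF G W, of "k + 2"] H
    by (simp add: numeral_eq_Suc del: Gk.simps)
  finally show "card V = k + 7" by simp
qed

lemma zero_realizes_capture:
  assumes "zero_realizes V E vec" shows "capture_time V E = length vec"
proof -
  have "rcv V E = vec" "type0 V E" using assms by (auto simp: zero_realizes_def realizes_def)
  then show ?thesis using capture_type0[OF G W] type1_iff[OF G W]
    by (auto simp: type0_def corner_rank_top rcv_eq)
qed

lemma top_cases:
  obtains (clique) "top_index V E = 0"
  | (type1) m where "top_index V E = Suc m" "dominated E (Gk V E m)" "capture_time V E = Suc m"
  | (type0) m where "top_index V E = Suc m" "\<not> dominated E (Gk V E m)" "capture_time V E = m + 2"
proof (cases "top_index V E")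
  case 0 then show ?thesis by (rule clique)
next
  case (Suc m)
  show ?thesis
  proof (cases "dominated E (Gk V E m)")
    case True
    then show ?thesis using type1[OF Suc] capture_type1[OF G W] Suc by simp
  next
    case False
    then show ?thesis using type0[OF Suc] capture_type0[OF G W] Suc by simp
  qed
qed

section \<open>Upper bound and extremal graphs of each order\<close>

lemma card_pos: "card V \<ge> 1"
  using G by (simp add: graph_def Suc_le_eq card_gt_0_iff)

lemma capture_le: "capture_time V E \<le> max_capture (card V)"
proof (cases "card V = 1")
  case True then show ?thesis using capture_time_singleton[OF G] by simp
next
  case False
  then have c: "card V \<ge> 2" using card_pos by simp
  show ?thesis
  proof (cases rule: top_cases)
    case clique
    then show ?thesis using capture_clique[OF G W c] c by (auto simp: max_capture_def)
  next
    case (type1 m)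
    have "m = 0 \<or> m = 1 \<or> m \<ge> 2" by linarith
    then show ?thesis using type1_card[OF G W type1(1,2)] type1(3)
      by (auto simp: max_capture_def)
  next
    case (type0 m)
    have "m = 0 \<or> m = 1 \<or> m = 2 \<or> m \<ge> 3" by linarith
    then show ?thesis using type0_card[OF G W type0(1,2)] type0(3)
      by (auto simp: max_capture_def)
  qed
qed

lemma capture_clique_le: "top_index V E = 0 \<Longrightarrow> capture_time V E \<le> 1"
  using capture_clique[OF G W] capture_time_singleton[OF G] card_pos
  by (cases "card V = 1") auto

lemma clique_V: "top_index V E = 0 \<Longrightarrow> x \<in> V \<Longrightarrow> y \<in> V \<Longrightarrow> E x y"
  using top_clique[OF G W] by (simp add: is_clique_def)

lemma small_clique_path:
  assumes "card V = n" "n \<le> 2" "top_index V E = 0" shows "\<exists>f. path_on E V n f"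
proof -
  have "finite V" using G by (simp add: graph_def)
  then obtain f where f: "bij_betw f {0..<n} V" using assms(1) ex_bij_betw_nat_finite by metis
  then have "E (f i) (f j)" if "i < n" "j < n" for i j
    using clique_V[OF assms(3)] bij_betwE[OF f] that by simp
  then have "path_on E V n f" using f assms(2) by (auto simp: path_on_def)
  then show ?thesis by blast
qed

lemma order_le_2:
  assumes "card V = n" "n \<le> 2" shows "\<exists>f. path_on E V n f"
proof (cases rule: top_cases)
  case clique then show ?thesis using small_clique_path assms by blast
next
  case (type1 m)
  have "m = 0 \<or> m = 1 \<or> m \<ge> 2" by linarith
  then show ?thesis using type1_card[OF G W type1(1,2)] assms by auto
next
  case (type0 m)
  have "m = 0 \<or> m = 1 \<or> m = 2 \<or> m \<ge> 3" by linarith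
  then show ?thesis using type0_card[OF G W type0(1,2)] assms by auto
qed

lemma order_3:
  assumes "card V = 3" shows "(\<exists>f. path_on E V 3 f) \<or> graph_iso V E K3_V K3_E"
proof (cases rule: top_cases)
  case clique
  have "finite V" using G by (simp add: graph_def)
  then obtain f where f: "bij_betw f {0..<3::nat} V" using assms ex_bij_betw_nat_finite by metis
  have K: "K3_V = {0..<3}" by (auto simp: K3_V_def)
  have "graph_iso V E K3_V K3_E"
    by (rule graph_isoI[of f]) (use f clique_V[OF clique] bij_betwE[OF f] in \<open>auto simp: K K3_E_def\<close>)
  then show ?thesis by blast
next
  case (type1 m)
  have "m = 0 \<or> m = 1 \<or> m \<ge> 2" by linarith
  then show ?thesis using type1_card[OF G W type1(1,2)] assms by auto
next
  case (type0 m)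
  have "m = 0 \<or> m = 1 \<or> m = 2 \<or> m \<ge> 3" by linarith
  then show ?thesis using type0_card[OF G W type0(1,2)] assms by auto
qed

lemma order_4:
  assumes "card V = 4" "capture_time V E = 2" shows "\<exists>f. path_on E V 4 f"
proof (cases rule: top_cases)
  case clique then show ?thesis using capture_clique_le assms by simp
next
  case (type1 m) then show ?thesis using type1_card(2)[OF G W type1(1,2)] assms by simp
next
  case (type0 m) then show ?thesis using type0_card(1)[OF G W type0(1,2)] assms by simp
qed

lemma type0_rcv:
  assumes "top_index V E = Suc m" "\<not> dominated E (Gk V E m)" "rcv V E = vec"
  shows "zero_realizes V E vec"
  using assms type1_iff[OF G W] G W
  by (auto simp: zero_realizes_def realizes_def type0_def corner_rank_top)

lemma order_5:
  assumes "card V = 5" "capture_time V E = 2"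
  shows "(\<exists>f. path_on E V 5 f) \<or> zero_realizes V E [2, 3] \<or> zero_realizes V E [3, 2]"
proof (cases rule: top_cases)
  case clique then show ?thesis using capture_clique_le assms by simp
next
  case (type1 m) then show ?thesis using type1_card(2)[OF G W type1(1,2)] assms by simp
next
  case (type0 m)
  then have m: "m = 0" using assms by simp
  have r: "rcv V E = [card (Gk V E 1), layer V E 0]" by (simp add: rcv_eq type0(1) m)
  have "card (Gk V E 1) + layer V E 0 = 5" using card_layers[OF G W, of 0] assms(1) by simp
  moreover have "card (Gk V E 1) \<ge> 2" "layer V E 0 \<ge> 2"
    using type0_layers(1,2)[OF G W type0(1,2)] m by simp_all
  ultimately have "rcv V E = [2, 3] \<or> rcv V E = [3, 2]" unfolding r by auto
  then show ?thesis using type0_rcv[OF type0(1,2)] by blast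
qed

lemma order_6:
  assumes "card V = 6" "capture_time V E = 3" shows "\<exists>f. path_on E V 6 f"
proof (cases rule: top_cases)
  case clique then show ?thesis using capture_clique_le assms by simp
next
  case (type1 m) then show ?thesis using type1_card(3)[OF G W type1(1,2)] assms by simp
next
  case (type0 m) then show ?thesis using type0_card(2)[OF G W type0(1,2)] assms by simp
qed

text \<open>Capture time 3 means type 1 with four classes or type 0 with three. The former meets the
  bound 7 with equality, which leaves the path and the vector (2,2,2,1), realized only by H_7. The
  latter splits 7 into three parts of size at least 2.\<close>

lemma order_7:
  assumes "card V = 7" "capture_time V E = 3"
  shows "(\<exists>f. path_on E V 7 f) \<or> graph_iso V E H7_V H7_E \<or>
    zero_realizes V E [2, 2, 3] \<or> zero_realizes V E [2, 3, 2] \<or> zero_realizes V E [3, 2, 2]"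
proof (cases rule: top_cases)
  case clique then show ?thesis using capture_clique_le assms by simp
next
  case (type1 m)
  then have m: "m = 2" using assms by simp
  note R = refl_graph_layers[OF G W] and C = core_layer[OF G W, symmetric]
  have "(\<exists>f. path_on E V 7 f) \<or>
      card (Gk V E 3) = 2 \<and> layer V E 2 = 2 \<and> layer V E 1 = 2 \<and> layer V E 0 = 1"
    using type1_card(4)[OF G W type1(1,2)] m assms(1) by (simp add: eval_nat_numeral del: Gk.simps)
  moreover have "graph_iso V E H7_V H7_E"
    if H: "card (Gk V E 3) = 2" "layer V E 2 = 2" "layer V E 1 = 2" "layer V E 0 = 1"
  proof -
    obtain d where d: "Gk V E 0 - Gk V E (Suc 0) = {d}" by (rule single_layer[OF G W H(4)])
    have nd: "\<not> dominated E (Gk V E (Suc 0))" using type1_layers(3)[OF G W type1(1,2), of 1] m by simp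
    have "graph_iso (Gk V E 0) E H7_V H7_E"
      by (rule H7_unique[OF R C C C _ nd])
        (use type1(2) m H d in \<open>simp_all add: layer_def eval_nat_numeral del: Gk.simps\<close>)
    then show ?thesis by simp
  qed
  ultimately show ?thesis by blast
next
  case (type0 m)
  then have m: "m = 1" using assms by simp
  have r: "rcv V E = [card (Gk V E 2), layer V E 1, layer V E 0]"
    by (simp add: rcv_eq type0(1) m eval_nat_numeral del: Gk.simps)
  have "card (Gk V E 2) + layer V E 1 + layer V E 0 = 7"
    using card_layers[OF G W, of 0] card_layers[OF G W, of 1] assms(1)
    by (simp add: eval_nat_numeral del: Gk.simps(2))
  moreover have "card (Gk V E 2) \<ge> 2" "layer V E 1 \<ge> 2" "layer V E 0 \<ge> 2"
    using type0_layers(1-3)[OF G W type0(1,2)] m by (simp_all add: eval_nat_numeral del: Gk.simps)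
  ultimately have "rcv V E = [2, 2, 3] \<or> rcv V E = [2, 3, 2] \<or> rcv V E = [3, 2, 2]"
    unfolding r by auto
  then show ?thesis using type0_rcv[OF type0(1,2)] by blast
qed

lemma type1_H7plus:
  assumes t: "top_index V E = Suc m" and d: "dominated E (Gk V E m)"
    and c: "m \<ge> 2" "card V = m + 5" "m \<noteq> 2"
  shows "in_H7plus_k (m - 2) V E"
proof -
  have "m = Suc (Suc (m - 2))" using c by simp
  then obtain k where m: "m = Suc (Suc k)" by blast
  show ?thesis
    using type1_card(4)[OF G W t d c(1,2)] c(3) t unfolding in_H7plus_k_iff m
    by (auto simp: eval_nat_numeral simp del: Gk.simps)
qed

lemma order_8:
  assumes "card V = 8" "capture_time V E = 4"
  shows "(\<exists>f. path_on E V 8 f) \<or> in_H7plus_k 1 V E"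
proof (cases rule: top_cases)
  case clique then show ?thesis using capture_clique_le assms by simp
next
  case (type1 m)
  then have "m = 3" using assms by simp
  then show ?thesis using type1_H7plus[OF type1(1,2)] assms by simp
next
  case (type0 m) then show ?thesis using type0_card(3)[OF G W type0(1,2)] assms by simp
qed

text \<open>For type 1 the capture time gives exactly \<open>m + 5\<close> vertices, the equality
  case of \<open>type1_card\<close>. For type 0 it would give \<open>m + 6\<close>, one fewer than
  \<open>type0_card\<close> requires.\<close>

lemma order_ge_9:
  assumes "card V \<ge> 9" "capture_time V E = card V - 4"
  shows "in_H7plus V E"
proof (cases rule: top_cases)
  case clique then show ?thesis using capture_clique_le assms by simp
next
  case (type1 m)
  then have "m \<ge> 2" "card V = m + 5" "m \<noteq> 2" using assms by simp_all
  then show ?thesis using type1_H7plus[OF type1(1,2)] unfolding in_H7plus_def by blast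
next
  case (type0 m)
  then have "m \<ge> 3" "card V = m + 6" using assms by simp_all
  then show ?thesis using type0_card(4)[OF G W type0(1,2)] by simp
qed

lemma path_iso_capture:
  assumes "graph_iso V E (path_V n) (path_E n)" "card V = n" shows "capture_time V E = n div 2"
  using capture_iso(2)[OF G path_graph assms(1)] path_capture(2) card_pos assms(2) by simp

end

lemma capt_eq:
  assumes "n \<ge> 1" shows "capt n = max_capture n"
  unfolding capt_def
proof (rule Greatest_equality)
  show "\<exists>V :: nat set. \<exists>E. graph V E \<and> card V = n \<and> cop_win V E \<and> capture_time V E = max_capture n"
  proof (cases "n < 8")
    case True
    then show ?thesis using path_graph[OF assms] path_capture[OF assms]
      by (intro exI[of _ "path_V n"] exI[of _ "path_E n"]) (simp add: max_capture_def path_V_def)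
  next
    case False
    then have n: "n = 7 + (n - 7)" by simp
    show ?thesis using tail_graph[of "n - 7"] tail_capture[of "n - 7"] False
      by (intro exI[of _ "{0..<7 + (n - 7)}"] exI[of _ "tail_E (n - 7)"]) (simp add: max_capture_def)
  qed
  fix t assume "\<exists>V :: nat set. \<exists>E. graph V E \<and> card V = n \<and> cop_win V E \<and> capture_time V E = t"
  then show "t \<le> max_capture n" using capture_le by blast
qed

lemma CT_maximal_iff:
  assumes "graph V E" "cop_win V E"
  shows "CT_maximal V E \<longleftrightarrow> capture_time V E = max_capture (card V)"
  using assms capt_eq[OF card_pos[OF assms]] by (simp add: CT_maximal_def)

lemma K3_capture:
  assumes "graph V E" "graph_iso V E K3_V K3_E" "cop_win V E" shows "capture_time V E = 1"
proof -
  have K: "graph K3_V K3_E" by (auto simp: graph_def K3_V_def K3_E_def)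
  have w: "cop_win K3_V K3_E" using capture_iso(1)[OF assms(1) K assms(2)] assms(3) by simp
  have "dominated K3_E (Gk K3_V K3_E 0)" by (auto simp: dominated_def K3_V_def K3_E_def)
  moreover have "card K3_V \<ge> 2" by (simp add: K3_V_def)
  ultimately have "capture_time K3_V K3_E = 1"
    using capture_time_eq_iff[OF K _ w, of 0] by simp
  then show ?thesis using capture_iso(2)[OF assms(1) K assms(2)] by simp
qed

theorem theorem4p3:
  shows
   "(\<forall>n::nat. n \<ge> 7 \<longrightarrow> capt n = n - 4)
  \<and> (\<forall>(V :: 'a set) E. graph V E \<and> cop_win V E \<and> card V \<ge> 9 \<longrightarrow>
        (CT_maximal V E \<longleftrightarrow> in_H7plus V E))
  \<and> capt 1 = 0 \<and> capt 2 = 1 \<and> capt 3 = 1 \<and> capt 4 = 2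
  \<and> capt 5 = 2 \<and> capt 6 = 3 \<and> capt 7 = 3 \<and> capt 8 = 4
  \<and> (\<forall>(V :: 'a set) E. graph V E \<and> cop_win V E \<longrightarrow>
       (card V = 1 \<longrightarrow> (CT_maximal V E \<longleftrightarrow> graph_iso V E (path_V 1) (path_E 1)))
     \<and> (card V = 2 \<longrightarrow> (CT_maximal V E \<longleftrightarrow> graph_iso V E (path_V 2) (path_E 2)))
     \<and> (card V = 3 \<longrightarrow> (CT_maximal V E \<longleftrightarrow>
            graph_iso V E (path_V 3) (path_E 3) \<or> graph_iso V E K3_V K3_E))
     \<and> (card V = 4 \<longrightarrow> (CT_maximal V E \<longleftrightarrow> graph_iso V E (path_V 4) (path_E 4)))
     \<and> (card V = 5 \<longrightarrow> (CT_maximal V E \<longleftrightarrow>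
            graph_iso V E (path_V 5) (path_E 5) \<or> zero_realizes V E [2, 3]
            \<or> zero_realizes V E [3, 2]))
     \<and> (card V = 6 \<longrightarrow> (CT_maximal V E \<longleftrightarrow> graph_iso V E (path_V 6) (path_E 6)))
     \<and> (card V = 7 \<longrightarrow> (CT_maximal V E \<longleftrightarrow>
            graph_iso V E (path_V 7) (path_E 7) \<or> graph_iso V E H7_V H7_E
            \<or> zero_realizes V E [2, 2, 3] \<or> zero_realizes V E [2, 3, 2]
            \<or> zero_realizes V E [3, 2, 2]))
     \<and> (card V = 8 \<longrightarrow> (CT_maximal V E \<longleftrightarrow>
            graph_iso V E (path_V 8) (path_E 8) \<or> in_H7plus_k 1 V E)))"
proof (intro conjI allI impI; (elim conjE)?)
  fix n :: nat assume "7 \<le> n"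
  then show "capt n = n - 4" by (cases "n = 7") (simp_all add: capt_eq max_capture_def)
next
  fix V :: "'a set" and E
  assume G: "graph V E" and W: "cop_win V E" and c: "card V \<ge> 9"
  have "capture_time V E = card V - 4" if H: "in_H7plus V E"
  proof -
    obtain k where "in_H7plus_k k V E" using H by (auto simp: in_H7plus_def)
    from H7plus_capture[OF G W this] show ?thesis by simp
  qed
  then show "CT_maximal V E \<longleftrightarrow> in_H7plus V E"
    using CT_maximal_iff[OF G W] order_ge_9[OF G W c] c by (auto simp: max_capture_def)
next
  show "capt 1 = 0" "capt 2 = 1" "capt 3 = 1" "capt 4 = 2" "capt 5 = 2" "capt 6 = 3" "capt 7 = 3" "capt 8 = 4"
    by (simp_all add: capt_eq max_capture_def)
next
  fix V :: "'a set" and E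
  assume G: "graph V E" and W: "cop_win V E"
  note iff = CT_maximal_iff[OF G W] max_capture_def graph_iso_path_iff
  note P = path_iso_capture[OF G W, unfolded graph_iso_path_iff]
  show "CT_maximal V E \<longleftrightarrow> graph_iso V E (path_V 1) (path_E 1)" if "card V = 1"
    using order_le_2[OF G W that] P[OF _ that] that by (auto simp: iff)
  show "CT_maximal V E \<longleftrightarrow> graph_iso V E (path_V 2) (path_E 2)" if "card V = 2"
    using order_le_2[OF G W that] P[OF _ that] that by (auto simp: iff)
  show "CT_maximal V E \<longleftrightarrow> graph_iso V E (path_V 3) (path_E 3) \<or> graph_iso V E K3_V K3_E" if "card V = 3"
    using order_3[OF G W that] P[OF _ that] K3_capture[OF G _ W] that by (auto simp: iff)
  show "CT_maximal V E \<longleftrightarrow> graph_iso V E (path_V 4) (path_E 4)" if "card V = 4"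
    using order_4[OF G W that] P[OF _ that] that by (auto simp: iff)
  show "CT_maximal V E \<longleftrightarrow> graph_iso V E (path_V 5) (path_E 5) \<or> zero_realizes V E [2, 3]
            \<or> zero_realizes V E [3, 2]" if "card V = 5"
    using order_5[OF G W that] P[OF _ that] zero_realizes_capture[OF G W] that by (fastforce simp: iff)
  show "CT_maximal V E \<longleftrightarrow> graph_iso V E (path_V 6) (path_E 6)" if "card V = 6"
    using order_6[OF G W that] P[OF _ that] that by (auto simp: iff)
  show "CT_maximal V E \<longleftrightarrow> graph_iso V E (path_V 7) (path_E 7) \<or> graph_iso V E H7_V H7_E
            \<or> zero_realizes V E [2, 2, 3] \<or> zero_realizes V E [2, 3, 2]
            \<or> zero_realizes V E [3, 2, 2]" if "card V = 7"
    using order_7[OF G W that] P[OF _ that] zero_realizes_capture[OF G W] that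
      capture_iso(2)[OF G H7_capture(1)] H7_capture(2) by (fastforce simp: iff)
  show "CT_maximal V E \<longleftrightarrow> graph_iso V E (path_V 8) (path_E 8) \<or> in_H7plus_k 1 V E" if "card V = 8"
    using order_8[OF G W that] P[OF _ that] H7plus_capture(1)[OF G W, of 1] that by (auto simp: iff)
qed

end
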